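(* Let $\Omega$ be a bounded domain in $\mathbb{R}^m$. Let $\vec F\in L^1_{loc}(\Omega)$ be a vector field and suppose $u\in C^1(\Omega)\cap C^2(\Omega\setminus S(u))\cap C^0(\bar\Omega)$ satisfies $$\operatorname{div}\frac{\nabla u+\vec F}{|\nabla u+\vec F|}=H\quad\text{in }\Omega\setminus S(u),$$ with $\vec F\in C^1(\Omega\setminus S(u))$ and $H\in C^0(\Omega\setminus S(u))\cap L^1_{loc}(\Omega)$. Suppose $H_{m-1}(S(u))$, the $(m-1)$-dimensional Hausdorff measure of $S(u)$, vanishes. Then $u$ is a weak solution to $\operatorname{div}\frac{\nabla u+\vec F}{|\nabla u+\vec F|}=H$ in $\Omega$; and $u$ is a minimizer for $\mathcal{F}(u)=\int_\Omega\{|\nabla u+\vec F|+Hu\}$ if also $u\in W^{1,1}(\Omega)$ and $H\in L^\infty(\Omega)$ (and $\vec F\in L^1(\Omega)$).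
   Context: $S(u)=\{\nabla u+\vec F=0\}$ is the singular set of $u$, and $N(u)=\frac{\nabla u+\vec F}{|\nabla u+\vec F|}$ on $\Omega\setminus S(u)$. Weak solution (for $\vec F,H\in L^1_{loc}(\Omega)$): a weakly differentiable function $u$ on $\Omega$ is a weak solution to $\operatorname{div}N(u)=H$ in $\Omega$ if for every $\varphi\in C_0^\infty(\Omega)$ $$\int_{S(u)}|\nabla\varphi|+\int_{\Omega\setminus S(u)}N(u)\cdot\nabla\varphi+\int_\Omega H\varphi\ge0.$$ Minimizer (for $\vec F\in L^1(\Omega)$, $H\in L^\infty(\Omega)$): $u\in W^{1,1}(\Omega)$ is a minimizer for $\mathcal{F}$ if $\mathcal{F}(u)\le\mathcal{F}(u+\varphi)$ for every $\varphi\in W^{1,1}_0(\Omega)$. *)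

theory Defs
  imports "HOL-Analysis.Analysis"
begin

section \<open>Classical differentiability\<close>

text \<open>
  \<open>Ck_on k f U\<close> is \<open>f \<in> C\<^sup>k(U)\<close> for open \<open>U\<close>: all iterated directional derivatives up to
  order \<open>k\<close> exist and are continuous. For \<open>k \<ge> 1\<close> differentiability is differentiability at the
  points of \<open>U\<close> in the ambient space. On the complement of a singular set, openness need not be
  assumed: if \<open>\<nabla>u\<close> is continuous on an open \<open>\<Omega>\<close> and \<open>F\<close> is differentiable at every point of
  \<open>\<Omega> - S(u)\<close>, then \<open>\<nabla>u + F\<close> is continuous and nonzero at these points, so \<open>\<Omega> - S(u)\<close> is open.
\<close>

primrec Ck_on ::
  "nat \<Rightarrow> ('a::euclidean_space \<Rightarrow> 'b::real_normed_vector) \<Rightarrow> 'a set \<Rightarrow> bool" where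
  "Ck_on 0 f U \<longleftrightarrow> continuous_on U f"
| "Ck_on (Suc k) f U \<longleftrightarrow>
     (\<forall>x\<in>U. f differentiable (at x)) \<and>
     (\<forall>v. Ck_on k (\<lambda>x. frechet_derivative f (at x) v) U)"

definition grad :: "('a::euclidean_space \<Rightarrow> real) \<Rightarrow> 'a \<Rightarrow> 'a" where
  "grad f x = (THE D. GDERIV f x :> D)"

definition divergence :: "('a::euclidean_space \<Rightarrow> 'a) \<Rightarrow> 'a \<Rightarrow> real" where
  "divergence V x = (\<Sum>b\<in>Basis. frechet_derivative V (at x) b \<bullet> b)"

text \<open>The class \<open>C\<^sub>0\<^sup>\<infinity>(\<Omega>)\<close>; its members are extended by zero to the whole space.\<close>

definition test_function :: "'a::euclidean_space set \<Rightarrow> ('a \<Rightarrow> real) \<Rightarrow> bool" where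
  "test_function \<Omega> \<phi> \<longleftrightarrow>
     (\<forall>k. Ck_on k \<phi> UNIV) \<and>
     compact (closure {x. \<phi> x \<noteq> 0}) \<and> closure {x. \<phi> x \<noteq> 0} \<subseteq> \<Omega>"

section \<open>Hausdorff measure\<close>

text \<open>
  The weight of a covering set is \<open>\<omega>\<^sub>s (diam C / 2)\<^sup>s\<close>, where \<open>\<omega>\<^sub>s\<close> is the volume of the unit ball of
  dimension \<open>s\<close>. The exponent is a natural number, so for \<open>s = 0\<close> every nonempty set, singletons
  included, has weight 1. Covering sets are required to be bounded because \<open>diameter\<close> is
  unspecified on unbounded sets.
\<close>

definition hausdorff_weight :: "nat \<Rightarrow> 'a::metric_space set \<Rightarrow> ennreal" where
  "hausdorff_weight s C =
     (if C = {} then 0 else ennreal (unit_ball_vol (real s) * (diameter C / 2) ^ s))"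

definition hausdorff_premeasure :: "nat \<Rightarrow> real \<Rightarrow> 'a::metric_space set \<Rightarrow> ennreal" where
  "hausdorff_premeasure s \<delta> A =
     (INF C \<in> {C :: nat \<Rightarrow> 'a set.
                 A \<subseteq> (\<Union>i. C i) \<and> (\<forall>i. bounded (C i) \<and> diameter (C i) \<le> \<delta>)}.
        \<Sum>i. hausdorff_weight s (C i))"

definition hausdorff_measure :: "nat \<Rightarrow> 'a::metric_space set \<Rightarrow> ennreal" where
  "hausdorff_measure s A = (SUP \<delta>\<in>{0<..}. hausdorff_premeasure s \<delta> A)"

section \<open>Function spaces and weak gradients\<close>

definition L1_loc :: "'a::euclidean_space set \<Rightarrow> ('a \<Rightarrow> 'b::euclidean_space) \<Rightarrow> bool" where
  "L1_loc \<Omega> f \<longleftrightarrow> (\<forall>K. compact K \<and> K \<subseteq> \<Omega> \<longrightarrow> f absolutely_integrable_on K)"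

definition L_infinity :: "'a::euclidean_space set \<Rightarrow> ('a \<Rightarrow> real) \<Rightarrow> bool" where
  "L_infinity \<Omega> f \<longleftrightarrow>
     f \<in> borel_measurable (lebesgue_on \<Omega>) \<and> (\<exists>M. AE x in lebesgue_on \<Omega>. \<bar>f x\<bar> \<le> M)"

definition has_weak_grad ::
  "'a::euclidean_space set \<Rightarrow> ('a \<Rightarrow> real) \<Rightarrow> ('a \<Rightarrow> 'a) \<Rightarrow> bool" where
  "has_weak_grad \<Omega> u G \<longleftrightarrow>
     L1_loc \<Omega> u \<and> L1_loc \<Omega> G \<and>
     (\<forall>\<phi>. test_function \<Omega> \<phi> \<longrightarrow>
        (LINT x:\<Omega>|lebesgue. u x *\<^sub>R grad \<phi> x) = - (LINT x:\<Omega>|lebesgue. \<phi> x *\<^sub>R G x))"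

definition weakly_differentiable :: "'a::euclidean_space set \<Rightarrow> ('a \<Rightarrow> real) \<Rightarrow> bool" where
  "weakly_differentiable \<Omega> u \<longleftrightarrow> (\<exists>G. has_weak_grad \<Omega> u G)"

text \<open>
  A representative of the weak gradient. Weak gradients on an open set are unique up to null
  sets, so the integrals below do not depend on the choice.
\<close>

definition weak_grad :: "'a::euclidean_space set \<Rightarrow> ('a \<Rightarrow> real) \<Rightarrow> 'a \<Rightarrow> 'a" where
  "weak_grad \<Omega> u = (SOME G. has_weak_grad \<Omega> u G)"

definition W11 :: "'a::euclidean_space set \<Rightarrow> ('a \<Rightarrow> real) \<Rightarrow> bool" where
  "W11 \<Omega> u \<longleftrightarrow>
     weakly_differentiable \<Omega> u \<and>
     u absolutely_integrable_on \<Omega> \<and> weak_grad \<Omega> u absolutely_integrable_on \<Omega>"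

definition W11_norm :: "'a::euclidean_space set \<Rightarrow> ('a \<Rightarrow> real) \<Rightarrow> real" where
  "W11_norm \<Omega> u =
     (LINT x:\<Omega>|lebesgue. \<bar>u x\<bar>) + (LINT x:\<Omega>|lebesgue. norm (weak_grad \<Omega> u x))"

text \<open>\<open>W\<^sub>0\<^sup>1\<^sup>,\<^sup>1(\<Omega>)\<close> is the closure of \<open>C\<^sub>0\<^sup>\<infinity>(\<Omega>)\<close> in \<open>W\<^sup>1\<^sup>,\<^sup>1(\<Omega>)\<close>.\<close>

definition W11_0 :: "'a::euclidean_space set \<Rightarrow> ('a \<Rightarrow> real) \<Rightarrow> bool" where
  "W11_0 \<Omega> \<phi> \<longleftrightarrow>
     W11 \<Omega> \<phi> \<and>
     (\<exists>\<psi>. (\<forall>n::nat. test_function \<Omega> (\<psi> n)) \<and>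
          (\<lambda>n. W11_norm \<Omega> (\<lambda>x. \<psi> n x - \<phi> x)) \<longlonglongrightarrow> 0)"

section \<open>The equation and the functional\<close>

text \<open>
  The singular set \<open>S(u)\<close> and the direction \<open>N(u)\<close> depend on \<open>u\<close> through its gradient field \<open>p\<close>:
  \<open>p\<close> is \<open>grad u\<close> for \<open>u \<in> C\<^sup>1(\<Omega>)\<close>, where \<open>S(u)\<close> is determined pointwise, and \<open>weak_grad \<Omega> u\<close>
  for weakly differentiable \<open>u\<close>, where \<open>S(u)\<close> is determined up to a null set.
\<close>

definition singular_set ::
  "'a::euclidean_space set \<Rightarrow> ('a \<Rightarrow> 'a) \<Rightarrow> ('a \<Rightarrow> 'a) \<Rightarrow> 'a set" where
  "singular_set \<Omega> F p = {x \<in> \<Omega>. p x + F x = 0}"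

definition direction :: "('a::euclidean_space \<Rightarrow> 'a) \<Rightarrow> ('a \<Rightarrow> 'a) \<Rightarrow> 'a \<Rightarrow> 'a" where
  "direction F p x = (p x + F x) /\<^sub>R norm (p x + F x)"

definition weak_solution ::
  "'a::euclidean_space set \<Rightarrow> ('a \<Rightarrow> 'a) \<Rightarrow> ('a \<Rightarrow> real) \<Rightarrow> ('a \<Rightarrow> real) \<Rightarrow> bool" where
  "weak_solution \<Omega> F H u \<longleftrightarrow>
     L1_loc \<Omega> F \<and> L1_loc \<Omega> H \<and> weakly_differentiable \<Omega> u \<and>
     (let p = weak_grad \<Omega> u; S = singular_set \<Omega> F p in
      \<forall>\<phi>. test_function \<Omega> \<phi> \<longrightarrow>
        (LINT x:S|lebesgue. norm (grad \<phi> x))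
        + (LINT x:\<Omega> - S|lebesgue. direction F p x \<bullet> grad \<phi> x)
        + (LINT x:\<Omega>|lebesgue. H x * \<phi> x) \<ge> 0)"

definition area_functional ::
  "'a::euclidean_space set \<Rightarrow> ('a \<Rightarrow> 'a) \<Rightarrow> ('a \<Rightarrow> real) \<Rightarrow> ('a \<Rightarrow> real) \<Rightarrow> real" where
  "area_functional \<Omega> F H u =
     (LINT x:\<Omega>|lebesgue. norm (weak_grad \<Omega> u x + F x) + H x * u x)"

definition is_minimizer ::
  "'a::euclidean_space set \<Rightarrow> ('a \<Rightarrow> 'a) \<Rightarrow> ('a \<Rightarrow> real) \<Rightarrow> ('a \<Rightarrow> real) \<Rightarrow> bool" where
  "is_minimizer \<Omega> F H u \<longleftrightarrow>
     F absolutely_integrable_on \<Omega> \<and> L_infinity \<Omega> H \<and> W11 \<Omega> u \<and>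
     (\<forall>\<phi>. W11_0 \<Omega> \<phi> \<longrightarrow>
        area_functional \<Omega> F H u \<le> area_functional \<Omega> F H (\<lambda>x. u x + \<phi> x))"

end

(*
  Proof idea. Let K be the support of the test function phi. The compact set of points of S in K has vanishing
  (m-1)-dimensional Hausdorff measure, so it is covered by finitely many balls with the sum of r^(m-1)
  arbitrarily small. A cutoff eta that vanishes on these balls and equals 1 off their doubles satisfies
  |grad eta| <= C/r on each of them, hence the integral of |grad eta| is at most C times that sum.
  The divergence theorem applied to eta phi N, which lives on the complement of S, therefore gives
  in the limit that the integral of N . grad phi + H phi over Omega is 0, with equality. The set S is
  null, so this is the weak inequality. As |N| <= 1 and H is bounded, the identity passes to
  W_0^{1,1} functions phi, and |p + q| >= |p| + N . q for p = grad u + F, q = grad phi yields minimality.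
*)
theory Submission
  imports Defs
begin

section \<open>Integration by parts with compact support\<close>

text \<open>Near S the derivative of N may be unbounded, and of div N = H only local integrability
  is known. Parts are therefore integrated only against C^1 functions whose compact support lies in
  the open set Omega - S. The price of the cutoff is the single term phi N . grad eta, where N
  enters through |N| <= 1 alone. The exponent m-1 is what remains when a gradient of size 1/r is
  integrated over a ball whose volume is of order r^m. A second obstacle comes from the definitions:
  weak solutions and minimizers refer to an arbitrarily chosen representative of the weak gradient.
  Facts about the classical gradient carry over only once weak gradients are known to be unique
  almost everywhere. This rests on the fundamental lemma of the calculus of variations, the one
  place where C^infinity functions have to be built; for the cutoffs C^1 suffices, which permits an
  elementary construction.\<close>

lemma integrable_compact_support:
  fixes f :: "'a::euclidean_space \<Rightarrow> 'b::euclidean_space"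
  assumes "continuous_on UNIV f" "compact K" "\<And>x. x \<notin> K \<Longrightarrow> f x = 0"
  shows "integrable lborel f"
proof -
  have "integrable lborel (\<lambda>x. indicator K x *\<^sub>R f x)"
    by (intro borel_integrable_compact assms continuous_on_subset[OF assms(1)]) auto
  moreover have "(\<lambda>x. indicator K x *\<^sub>R f x) = f"
    using assms(3) by (auto simp: indicator_def)
  ultimately show ?thesis by simp
qed

lemma gradient_eq_0:
  fixes f :: "'a::euclidean_space \<Rightarrow> real"
  assumes "GDERIV f x :> D" "open T" "x \<in> T" "\<And>y. y \<in> T \<Longrightarrow> f y = c"
  shows "D = 0"
proof -
  have "GDERIV f x :> 0"
    using has_derivative_transform_within_open[OF has_derivative_const assms(2,3), of c f] assms(4)
    by (auto simp: gderiv_def)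
  then have "(\<lambda>h. h \<bullet> D) = (\<lambda>h. h \<bullet> 0)"
    using assms(1) has_derivative_unique unfolding gderiv_def by blast
  from fun_cong[OF this, of D] show "D = 0"
    by simp
qed

lemma gradient_eq_0_outside:
  fixes f :: "'a::euclidean_space \<Rightarrow> real"
  assumes "\<And>x. GDERIV f x :> D x" "compact K" "\<And>x. x \<notin> K \<Longrightarrow> f x = 0" "x \<notin> K"
  shows "D x = 0"
  using assms by (intro gradient_eq_0[of f x "D x" "- K" 0])
    (auto intro: open_Compl compact_imp_closed)

text \<open>Translation invariance of Lebesgue measure makes the integral of every difference
  quotient of \<open>f\<close> in direction \<open>b\<close> vanish; dominated convergence passes
  this to the directional derivative.\<close>

lemma integral_gradient_eq_0:
  fixes f :: "'a::euclidean_space \<Rightarrow> real"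
  assumes der: "\<And>x. GDERIV f x :> D x" and cont: "continuous_on UNIV D"
    and K: "compact K" and supp: "\<And>x. x \<notin> K \<Longrightarrow> f x = 0"
  shows "(LINT x|lborel. D x \<bullet> b) = 0"
proof -
  have D0: "D x = 0" if "x \<notin> K" for x
    by (rule gradient_eq_0_outside[OF der K supp that])
  have "bounded (D ` K)"
    by (intro compact_imp_bounded compact_continuous_image K continuous_on_subset[OF cont]) auto
  then obtain M where M: "\<And>x. x \<in> K \<Longrightarrow> norm (D x) \<le> M" and "M > 0"
    unfolding bounded_pos by auto
  have M': "norm (D x) \<le> M" for x
    using M[of x] D0[of x] \<open>M > 0\<close> by (cases "x \<in> K") auto
  have contf: "continuous_on UNIV f"
    using der by (auto simp: gderiv_def continuous_on_eq_continuous_within intro: has_derivative_continuous)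
  have fint: "integrable lborel f"
    by (rule integrable_compact_support[OF contf K supp])
  obtain R where R: "K \<subseteq> cball 0 R" "R > 0"
    using bounded_subset_ballD[OF compact_imp_bounded[OF K], of 0] ball_subset_cball by blast
  define t :: "nat \<Rightarrow> real" where "t n = inverse (real (Suc n))" for n
  have t: "0 < t n" "t n \<le> 1" for n
    by (auto simp: t_def field_simps)
  define q where "q n x = (f (t n *\<^sub>R b + x) - f x) / t n" for n x
  have trans: "integrable lborel (\<lambda>x. f (c + x))" "(LINT x|lborel. f (c + x)) = (LINT x|lborel. f x)" for c
  proof -
    have bm: "f \<in> borel_measurable borel" "(+) c \<in> borel_measurable lborel"
      using borel_measurable_continuous_onI[OF contf] by auto
    show "integrable lborel (\<lambda>x. f (c + x))"
      using integrable_distr_eq[of "(+) c" lborel borel f] fint bm lborel_distr_plus[of c] by auto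
    show "(LINT x|lborel. f (c + x)) = (LINT x|lborel. f x)"
      using integral_distr[of "(+) c" lborel borel f] bm lborel_distr_plus[of c] by auto
  qed
  have q0: "(LINT x|lborel. q n x) = 0" for n
    unfolding q_def using trans fint by simp
  have qlim: "(\<lambda>n. q n x) \<longlonglongrightarrow> D x \<bullet> b" for x
  proof -
    have "((\<lambda>s. f (s *\<^sub>R b + x)) has_derivative (\<lambda>s. (s *\<^sub>R b) \<bullet> D x)) (at 0)"
    proof (rule has_derivative_compose[of "\<lambda>s. s *\<^sub>R b + x" "\<lambda>s. s *\<^sub>R b" 0 UNIV f "\<lambda>h. h \<bullet> D x"])
      show "(f has_derivative (\<lambda>h. h \<bullet> D x)) (at (0 *\<^sub>R b + x))"
        using der[of x] by (simp add: gderiv_def)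
    qed (auto intro!: derivative_eq_intros)
    then have "((\<lambda>s. f (s *\<^sub>R b + x)) has_field_derivative (D x \<bullet> b)) (at 0)"
      by (simp add: has_field_derivative_def inner_commute mult.commute[of "b \<bullet> D x"] mult_commute_abs)
    then have "((\<lambda>h. (f (h *\<^sub>R b + x) - f x) / h) \<longlongrightarrow> D x \<bullet> b) (at 0)"
      by (simp add: DERIV_def)
    moreover have "filterlim t (at 0) sequentially"
      using LIMSEQ_inverse_real_of_nat t unfolding filterlim_at t_def
      by (auto intro!: always_eventually)
    ultimately show ?thesis
      unfolding q_def by (rule filterlim_compose)
  qed
  \<comment> \<open>The mean value theorem bounds the quotient by \<open>M * norm b\<close>. As
    \<open>t n\<close> is at most 1, both values of \<open>f\<close> vanish outside the ball
    enlarged by \<open>norm b\<close>, so one integrable majorant serves all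
    \<open>n\<close>.\<close>
  have qb: "norm (q n x) \<le> M * norm b * indicator (cball 0 (R + norm b)) x" for n x
  proof (cases "x \<in> cball 0 (R + norm b)")
    case True
    have "norm (f (t n *\<^sub>R b + x) - f x) \<le> M * norm (t n *\<^sub>R b + x - x)"
    proof (rule differentiable_bound[of UNIV f "\<lambda>x h. h \<bullet> D x"])
      fix y :: 'a
      show "(f has_derivative (\<lambda>h. h \<bullet> D y)) (at y)" using der by (simp add: gderiv_def)
      show "onorm (\<lambda>h. h \<bullet> D y) \<le> M"
      proof (rule onorm_le)
        fix h
        have "norm (h \<bullet> D y) \<le> norm h * norm (D y)"
          using Cauchy_Schwarz_ineq2 by simp
        also have "\<dots> \<le> norm h * M"
          by (intro mult_left_mono M') simp
        finally show "norm (h \<bullet> D y) \<le> M * norm h" by (simp add: mult.commute)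
      qed
    qed auto
    then show ?thesis
      using True t[of n] by (simp add: q_def field_simps)
  next
    case False
    have "norm (t n *\<^sub>R b) \<le> norm b"
      using t[of n] by (simp add: mult_left_le_one_le)
    moreover have "norm x \<le> norm (t n *\<^sub>R b + x) + norm (t n *\<^sub>R b)"
      using norm_triangle_ineq4[of "t n *\<^sub>R b + x" "t n *\<^sub>R b"] by simp
    ultimately have "\<not> norm x \<le> R \<and> \<not> norm (t n *\<^sub>R b + x) \<le> R"
      using False R(2) norm_ge_zero[of b] unfolding mem_cball_0 by linarith
    then have "x \<notin> cball 0 R" "t n *\<^sub>R b + x \<notin> cball 0 R"
      unfolding mem_cball_0 by blast+
    then have "f x = 0" "f (t n *\<^sub>R b + x) = 0"
      using supp R(1) by blast+
    then show ?thesis using False by (simp add: q_def indicator_def)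
  qed
  have "(\<lambda>n. LINT x|lborel. q n x) \<longlonglongrightarrow> (LINT x|lborel. D x \<bullet> b)"
  proof (rule integral_dominated_convergence[where w="\<lambda>x. M * norm b * indicator (cball 0 (R + norm b)) x"])
    show "integrable lborel (\<lambda>x. M * norm b * indicator (cball 0 (R + norm b) :: 'a set) x)"
      by (intro integrable_mult_right integrable_real_indicator)
        (use emeasure_bounded_finite[OF bounded_cball] in auto)
    show "(\<lambda>x. D x \<bullet> b) \<in> borel_measurable lborel"
      using borel_measurable_continuous_onI[OF cont] by simp
    show "q n \<in> borel_measurable lborel" for n
      unfolding q_def using borel_measurable_continuous_onI[OF contf] trans(1)[of "t n *\<^sub>R b"] by measurable
  qed (use qlim qb in auto)
  then show ?thesis
    by (simp add: q0 LIMSEQ_const_iff)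
qed

text \<open>The open sets \<open>U\<close> and \<open>- L\<close> cover the space, and
  \<open>f\<close> is continuous on each of them.\<close>

lemma continuous_on_compact_support:
  fixes f :: "'a::euclidean_space \<Rightarrow> 'b::real_normed_vector"
  assumes "open U" "compact L" "L \<subseteq> U" "continuous_on U f" "\<And>x. x \<notin> L \<Longrightarrow> f x = 0"
  shows "continuous_on UNIV f"
proof -
  have "continuous_on (- L) f"
    using continuous_on_const[of "- L" 0] by (rule continuous_on_eq) (use assms(5) in auto)
  then have "continuous_on (U \<union> - L) f"
    using assms by (intro continuous_on_open_Un) (auto simp: compact_imp_closed)
  moreover have "U \<union> - L = UNIV" using assms(3) by auto
  ultimately show ?thesis by simp
qed

text \<open>The product \<open>f * \<psi>\<close> is C^1 on the whole space, although
  \<open>f\<close> may be arbitrary outside \<open>U\<close>, because \<open>\<psi>\<close> vanishes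
  off a compact subset of \<open>U\<close>. The integral of its gradient is 0.\<close>

lemma integration_by_parts_compact_support:
  fixes f \<psi> :: "'a::euclidean_space \<Rightarrow> real"
  assumes U: "open U" and L: "compact L" "L \<subseteq> U"
    and \<psi>: "\<And>x. GDERIV \<psi> x :> D x" "continuous_on UNIV D" "\<And>x. x \<notin> L \<Longrightarrow> \<psi> x = 0"
    and f: "\<And>x. x \<in> U \<Longrightarrow> GDERIV f x :> G x" "continuous_on U G"
  shows "integrable lborel (\<lambda>x. f x * (D x \<bullet> b))" "integrable lborel (\<lambda>x. \<psi> x * (G x \<bullet> b))"
    "(LINT x|lborel. f x * (D x \<bullet> b)) = - (LINT x|lborel. \<psi> x * (G x \<bullet> b))"
proof -
  have D0: "D x = 0" if "x \<notin> L" for x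
    by (rule gradient_eq_0_outside[OF \<psi>(1) L(1) \<psi>(3) that])
  have cf: "continuous_on U f"
    using f(1) U by (auto simp: gderiv_def continuous_on_eq_continuous_at intro: has_derivative_continuous)
  have c\<psi>: "continuous_on UNIV \<psi>"
    using \<psi>(1) by (auto simp: gderiv_def continuous_on_eq_continuous_within intro: has_derivative_continuous)
  let ?W = "\<lambda>x. f x *\<^sub>R D x + \<psi> x *\<^sub>R G x"
  have cU: "continuous_on U D" "continuous_on U \<psi>"
    by (rule continuous_on_subset[OF \<psi>(2)] continuous_on_subset[OF c\<psi>], simp)+
  have c1: "continuous_on UNIV (\<lambda>x. f x * (D x \<bullet> b))"
    by (rule continuous_on_compact_support[OF U L]) (intro continuous_intros cf cU, simp add: D0)
  have c2: "continuous_on UNIV (\<lambda>x. \<psi> x * (G x \<bullet> b))"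
    by (rule continuous_on_compact_support[OF U L]) (intro continuous_intros f(2) cU, simp add: \<psi>(3))
  have c3: "continuous_on UNIV ?W"
    by (rule continuous_on_compact_support[OF U L])
      (intro continuous_intros f(2) cf cU, simp add: D0 \<psi>(3))
  show i1: "integrable lborel (\<lambda>x. f x * (D x \<bullet> b))"
    by (rule integrable_compact_support[OF c1 L(1)]) (auto simp: D0)
  show i2: "integrable lborel (\<lambda>x. \<psi> x * (G x \<bullet> b))"
    by (rule integrable_compact_support[OF c2 L(1)]) (auto simp: \<psi>(3))
  have "(LINT x|lborel. ?W x \<bullet> b) = 0"
  proof (rule integral_gradient_eq_0[of "\<lambda>x. f x * \<psi> x", OF _ c3 L(1)])
    fix x
    show "GDERIV (\<lambda>x. f x * \<psi> x) x :> ?W x"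
    proof (cases "x \<in> U")
      case True
      then show ?thesis using GDERIV_mult[OF f(1) \<psi>(1), of x] by simp
    next
      case False
      then have "x \<in> - L" using L by auto
      moreover have "open (- L)" using L by (simp add: compact_imp_closed open_Compl)
      ultimately have "GDERIV (\<lambda>x. f x * \<psi> x) x :> 0"
        using has_derivative_transform_within_open[OF has_derivative_const \<open>open (- L)\<close> \<open>x \<in> - L\<close>,
            of 0 "\<lambda>x. f x * \<psi> x"] \<psi>(3)
        by (simp add: gderiv_def)
      moreover have "D x = 0" "\<psi> x = 0"
        using \<open>x \<in> - L\<close> D0 \<psi>(3) by auto
      ultimately show ?thesis by simp
    qed
  qed (auto simp: \<psi>(3))
  then show "(LINT x|lborel. f x * (D x \<bullet> b)) = - (LINT x|lborel. \<psi> x * (G x \<bullet> b))"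
    using i1 i2 by (simp add: inner_add_left)
qed

text \<open>The scalar formula is applied to each component \<open>V x \<bullet> b\<close> in its
  own direction \<open>b\<close>, and the results are summed over the basis.\<close>

lemma integral_inner_gradient_divergence:
  fixes V :: "'a::euclidean_space \<Rightarrow> 'a"
  assumes U: "open U" and L: "compact L" "L \<subseteq> U"
    and \<psi>: "\<And>x. GDERIV \<psi> x :> D x" "continuous_on UNIV D" "\<And>x. x \<notin> L \<Longrightarrow> \<psi> x = 0"
    and V: "\<And>x. x \<in> U \<Longrightarrow> V differentiable at x"
      "\<And>b. continuous_on U (\<lambda>x. frechet_derivative V (at x) b)"
  shows "integrable lborel (\<lambda>x. V x \<bullet> D x)" "integrable lborel (\<lambda>x. \<psi> x * divergence V x)"
    "(LINT x|lborel. V x \<bullet> D x) = - (LINT x|lborel. \<psi> x * divergence V x)"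
proof -
  \<comment> \<open>This is the transposed derivative of \<open>V\<close> applied to
    \<open>b\<close>. Its component along \<open>b\<close> is the diagonal entry that enters the
    divergence.\<close>
  let ?G = "\<lambda>b x. \<Sum>c\<in>Basis. (frechet_derivative V (at x) c \<bullet> b) *\<^sub>R c"
  have G: "GDERIV (\<lambda>x. V x \<bullet> b) x :> ?G b x" if "x \<in> U" for b x
  proof -
    have V': "(V has_derivative frechet_derivative V (at x)) (at x)"
      using V(1)[OF that] frechet_derivative_works by blast
    then interpret bounded_linear "frechet_derivative V (at x)"
      by (rule has_derivative_bounded_linear)
    have "frechet_derivative V (at x) h \<bullet> b = h \<bullet> ?G b x" for h
    proof -
      have "frechet_derivative V (at x) h = frechet_derivative V (at x) (\<Sum>c\<in>Basis. (h \<bullet> c) *\<^sub>R c)"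
        by (simp add: euclidean_representation)
      also have "\<dots> = (\<Sum>c\<in>Basis. (h \<bullet> c) *\<^sub>R frechet_derivative V (at x) c)"
        by (simp add: sum scale)
      finally show ?thesis
        by (simp add: inner_sum_left inner_sum_right mult.commute)
    qed
    then have "(\<lambda>h. frechet_derivative V (at x) h \<bullet> b) = (\<lambda>h. h \<bullet> ?G b x)"
      by blast
    then show ?thesis
      unfolding gderiv_def using has_derivative_inner_left[OF V', of b] by (simp only:)
  qed
  have cG: "continuous_on U (?G b)" for b
    by (intro continuous_intros V(2))
  have ibp: "integrable lborel (\<lambda>x. (V x \<bullet> c) * (D x \<bullet> b))"
    "integrable lborel (\<lambda>x. \<psi> x * (?G c x \<bullet> b))"
    "(LINT x|lborel. (V x \<bullet> c) * (D x \<bullet> b)) = - (LINT x|lborel. \<psi> x * (?G c x \<bullet> b))" for b c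
    by (rule integration_by_parts_compact_support[OF U L \<psi>(1,2) _ G cG]; use \<psi>(3) in blast)+
  have GB: "?G b x \<bullet> b = frechet_derivative V (at x) b \<bullet> b" if "b \<in> Basis" for b x
    using that by (simp add: inner_sum_left inner_Basis if_distrib cong: if_cong)
  have 1: "(\<lambda>x. V x \<bullet> D x) = (\<lambda>x. \<Sum>b\<in>Basis. (V x \<bullet> b) * (D x \<bullet> b))"
    by (rule ext, rule euclidean_inner)
  have 2: "(\<lambda>x. \<psi> x * divergence V x) = (\<lambda>x. \<Sum>b\<in>Basis. \<psi> x * (?G b x \<bullet> b))"
    by (simp add: divergence_def sum_distrib_left GB)
  show "integrable lborel (\<lambda>x. V x \<bullet> D x)"
    unfolding 1 by (intro Bochner_Integration.integrable_sum ibp(1))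
  show "integrable lborel (\<lambda>x. \<psi> x * divergence V x)"
    unfolding 2 by (intro Bochner_Integration.integrable_sum ibp(2))
  show "(LINT x|lborel. V x \<bullet> D x) = - (LINT x|lborel. \<psi> x * divergence V x)"
    unfolding 1 2
    by (subst (1 2) Bochner_Integration.integral_sum) (simp_all only: ibp sum_negf)
qed

section \<open>Cutoff functions near sets of vanishing Hausdorff measure\<close>

text \<open>Squaring removes the corner of \<open>max 0 t\<close>: at 0 the difference quotient is
  at most \<open>norm h\<close>. This is the C^1 building block of the cutoffs.\<close>

lemma DERIV_max_0_squared:
  "((\<lambda>t::real. (max 0 t)\<^sup>2) has_real_derivative 2 * max 0 t) (at t)"
proof -
  consider "t < 0" | "t > 0" | "t = 0" by linarith
  then show ?thesis
  proof cases
    case 1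
    have "((\<lambda>t::real. (max 0 t)\<^sup>2) has_real_derivative 0) (at t)"
      by (rule has_field_derivative_transform_within_open[of "\<lambda>_. 0" _ _ "{..<0}"]) (use 1 in auto)
    then show ?thesis using 1 by simp
  next
    case 2
    have "((\<lambda>t::real. (max 0 t)\<^sup>2) has_real_derivative 2 * t) (at t)"
      by (rule has_field_derivative_transform_within_open[of "\<lambda>t. t\<^sup>2" _ _ "{0<..}"])
        (use 2 in \<open>auto intro!: derivative_eq_intros\<close>)
    then show ?thesis using 2 by simp
  next
    case 3
    have "((\<lambda>h. (max 0 h)\<^sup>2 / h) \<longlongrightarrow> 0) (at (0::real))"
    proof (rule Lim_null_comparison)
      show "\<forall>\<^sub>F h in at (0::real). norm ((max 0 h)\<^sup>2 / h) \<le> norm h"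
      proof (intro always_eventually allI)
        show "norm ((max 0 h)\<^sup>2 / h) \<le> norm h" for h :: real
          by (cases "h > 0") (simp_all add: power2_eq_square)
      qed
      show "((\<lambda>h::real. norm h) \<longlongrightarrow> 0) (at 0)"
        by (intro tendsto_norm_zero tendsto_ident_at)
    qed
    then show ?thesis by (simp add: 3 DERIV_def)
  qed
qed

lemma ball_cutoff:
  fixes c :: "'a::euclidean_space"
  assumes r: "r > 0"
  obtains \<eta> D where "\<And>x. GDERIV \<eta> x :> D x" "continuous_on UNIV D" "\<And>x. 0 \<le> \<eta> x \<and> \<eta> x \<le> (1::real)"
    "\<And>x. x \<in> ball c r \<Longrightarrow> \<eta> x = 0" "\<And>x. dist c x \<ge> 2 * r \<Longrightarrow> \<eta> x = 1"
    "\<And>x. norm (D x) \<le> 16 / r * indicator (cball c (2 * r)) x"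
proof -
  \<comment> \<open>\<open>q (1 - q (2 - t))\<close> is a \<open>C\<^sup>1\<close> step from 0 for \<open>t \<le> 1\<close> to 1 for \<open>t \<ge> 2\<close>; it is applied to \<open>|x - c|\<^sup>2 / r\<^sup>2\<close>.\<close>
  define q :: "real \<Rightarrow> real" where "q t = (max 0 t)\<^sup>2" for t
  define \<beta> where "\<beta> t = q (1 - q (2 - t))" for t
  define \<beta>' where "\<beta>' t = 4 * max 0 (1 - q (2 - t)) * max 0 (2 - t)" for t
  have dq: "(q has_real_derivative 2 * max 0 t) (at t)" for t
    unfolding q_def by (rule DERIV_max_0_squared)
  have d\<beta>: "(\<beta> has_real_derivative \<beta>' t) (at t)" for t
  proof -
    have "((\<lambda>t. 1 - q (2 - t)) has_real_derivative 2 * max 0 (2 - t)) (at t)"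
      by (rule derivative_eq_intros DERIV_chain2[OF dq] refl | simp)+
    from DERIV_chain2[OF dq this] show ?thesis
      by (simp add: \<beta>_def[abs_def] \<beta>'_def mult.assoc)
  qed
  have c\<beta>': "continuous_on UNIV \<beta>'"
    unfolding \<beta>'_def q_def by (intro continuous_intros)
  have q01: "0 \<le> q t" "t \<le> 1 \<Longrightarrow> q t \<le> 1" "t \<le> 0 \<Longrightarrow> q t = 0" "t \<ge> 1 \<Longrightarrow> q t \<ge> 1" "q 1 = 1" for t
    by (auto simp: q_def max_def power_le_one)
  have \<beta>01: "0 \<le> \<beta> t" "\<beta> t \<le> 1" for t
    unfolding \<beta>_def using q01 by auto
  have \<beta>0: "\<beta> t = 0" if "t \<le> 1" for t
    unfolding \<beta>_def using q01(3,4) that by auto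
  have \<beta>1: "\<beta> t = 1" if "t \<ge> 2" for t
    unfolding \<beta>_def using q01 that by auto
  have \<beta>'2: "\<beta>' t = 0" if "t \<ge> 2" for t
    using that by (simp add: \<beta>'_def)
  \<comment> \<open>For \<open>t < 1\<close> the first factor of \<open>\<beta>'\<close> is 0; for
    \<open>t \<ge> 1\<close> both \<open>max\<close> factors lie between 0 and 1.\<close>
  have \<beta>'b: "\<bar>\<beta>' t\<bar> \<le> 4" for t
  proof (cases "2 - t \<le> 1")
    case True
    have "max 0 (1 - q (2 - t)) \<le> 1" "max 0 (2 - t) \<le> 1"
      using True q01(1) by auto
    then have "max 0 (1 - q (2 - t)) * max 0 (2 - t) \<le> 1 * 1"
      by (intro mult_mono) auto
    then show ?thesis by (simp add: \<beta>'_def abs_mult mult.assoc)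
  next
    case False
    then have "1 - q (2 - t) \<le> 0" using q01(4)[of "2 - t"] by simp
    then show ?thesis by (simp add: \<beta>'_def)
  qed
  \<comment> \<open>The squared distance, unlike the distance itself, is differentiable at the
    centre.\<close>
  define \<tau> where "\<tau> x = (x - c) \<bullet> (x - c) / r\<^sup>2" for x
  define D where "D x = (\<beta>' (\<tau> x) * 2 / r\<^sup>2) *\<^sub>R (x - c)" for x
  have \<tau>: "\<tau> x = (dist c x / r)\<^sup>2" for x
    by (subst dist_commute) (simp add: \<tau>_def power_divide dist_norm power2_norm_eq_inner)
  have g\<tau>: "GDERIV \<tau> x :> (2 / r\<^sup>2) *\<^sub>R (x - c)" for x
  proof -
    have "((\<lambda>x. (x - c) \<bullet> (x - c)) has_derivative (\<lambda>h. h \<bullet> (2 *\<^sub>R (x - c)))) (at x)"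
      by (auto intro!: derivative_eq_intros simp: inner_commute)
    from has_derivative_mult_right[OF this, of "inverse (r\<^sup>2)"] show ?thesis
      by (simp add: \<tau>_def[abs_def] gderiv_def divide_inverse mult_ac)
  qed
  have c\<tau>: "continuous_on UNIV \<tau>"
    unfolding \<tau>_def using r by (intro continuous_intros) auto
  have far: "\<tau> x \<ge> 2" if "dist c x \<ge> 2 * r" for x
  proof -
    have "2 \<le> dist c x / r" using that r by (simp add: field_simps)
    then have "2\<^sup>2 \<le> (dist c x / r)\<^sup>2" by (intro power_mono) auto
    then show ?thesis by (simp add: \<tau>)
  qed
  show thesis
  proof
    show "GDERIV (\<lambda>x. \<beta> (\<tau> x)) x :> D x" for x
      using GDERIV_DERIV_compose[OF g\<tau> d\<beta>, of x] by (simp add: D_def)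
    show "continuous_on UNIV D"
      unfolding D_def using r
      by (intro continuous_intros continuous_on_compose2[OF c\<beta>' c\<tau>]) auto
    show "0 \<le> \<beta> (\<tau> x) \<and> \<beta> (\<tau> x) \<le> 1" for x using \<beta>01 by simp
    show "\<beta> (\<tau> x) = 0" if "x \<in> ball c r" for x
    proof (rule \<beta>0)
      have "dist c x / r \<le> 1" using that r by simp
      then show "\<tau> x \<le> 1" unfolding \<tau> using r by (intro power_le_one) auto
    qed
    show "\<beta> (\<tau> x) = 1" if "dist c x \<ge> 2 * r" for x
      using far[OF that] by (rule \<beta>1)
    show "norm (D x) \<le> 16 / r * indicator (cball c (2 * r)) x" for x
    proof (cases "dist c x \<ge> 2 * r")
      case True
      then show ?thesis using \<beta>'2[OF far[OF True]] r by (simp add: D_def)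
    next
      case False
      \<comment> \<open>The constant 16 is 4 * 2 * 2: the bound 4 on \<open>\<beta>'\<close>, the
        factor 2 from differentiating the square, and \<open>dist c x < 2 * r\<close>.\<close>
      have "norm (D x) = \<bar>\<beta>' (\<tau> x)\<bar> * (2 / r\<^sup>2 * dist c x)"
        by (simp add: D_def dist_norm norm_minus_commute abs_mult)
      also have "\<dots> \<le> 4 * (2 / r\<^sup>2 * (2 * r))"
        using False r by (intro mult_mono \<beta>'b) auto
      also have "\<dots> = 16 / r" using r by (simp add: power2_eq_square)
      finally show ?thesis using False by simp
    qed
  qed
qed

text \<open>The product of the cutoffs of the single balls works. All factors lie between 0 and 1,
  so the product rule bounds the gradient by the sum of the single gradients, with no loss for
  overlapping balls.\<close>

lemma finite_balls_cutoff:
  fixes c :: "'i \<Rightarrow> 'a::euclidean_space"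
  assumes "finite I" "\<And>i. i \<in> I \<Longrightarrow> r i > 0"
  shows "\<exists>\<eta> D. (\<forall>x. GDERIV \<eta> x :> D x) \<and> continuous_on UNIV D \<and> (\<forall>x. 0 \<le> \<eta> x \<and> \<eta> x \<le> (1::real)) \<and>
    (\<forall>x\<in>(\<Union>i\<in>I. ball (c i) (r i)). \<eta> x = 0) \<and>
    (\<forall>x. (\<forall>i\<in>I. dist (c i) x \<ge> 2 * r i) \<longrightarrow> \<eta> x = 1) \<and>
    (\<forall>x. norm (D x) \<le> (\<Sum>i\<in>I. 16 / r i * indicator (cball (c i) (2 * r i)) x))"
  using assms
proof (induction I rule: finite_induct)
  case empty
  show ?case
    by (rule exI[of _ "\<lambda>_. 1"], rule exI[of _ "\<lambda>_. 0"]) (simp add: GDERIV_const)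
next
  case (insert j I)
  obtain \<eta> D where IH: "(\<forall>x. GDERIV \<eta> x :> D x) \<and> continuous_on UNIV D \<and> (\<forall>x. 0 \<le> \<eta> x \<and> \<eta> x \<le> (1::real)) \<and>
    (\<forall>x\<in>(\<Union>i\<in>I. ball (c i) (r i)). \<eta> x = 0) \<and>
    (\<forall>x. (\<forall>i\<in>I. dist (c i) x \<ge> 2 * r i) \<longrightarrow> \<eta> x = 1) \<and>
    (\<forall>x. norm (D x) \<le> (\<Sum>i\<in>I. 16 / r i * indicator (cball (c i) (2 * r i)) x))"
    using insert by auto
  then have \<eta>: "\<And>x. GDERIV \<eta> x :> D x" "continuous_on UNIV D" "\<And>x. 0 \<le> \<eta> x \<and> \<eta> x \<le> 1"
    "\<And>x. x \<in> (\<Union>i\<in>I. ball (c i) (r i)) \<Longrightarrow> \<eta> x = 0"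
    "\<And>x. \<forall>i\<in>I. dist (c i) x \<ge> 2 * r i \<Longrightarrow> \<eta> x = 1"
    "\<And>x. norm (D x) \<le> (\<Sum>i\<in>I. 16 / r i * indicator (cball (c i) (2 * r i)) x)"
    by blast+
  have "r j > 0" using insert.prems by simp
  from ball_cutoff[OF this, of "c j"] obtain \<eta>' D' where \<eta>': "\<And>x. GDERIV \<eta>' x :> D' x" "continuous_on UNIV D'"
    "\<And>x. 0 \<le> \<eta>' x \<and> \<eta>' x \<le> (1::real)"
    "\<And>x. x \<in> ball (c j) (r j) \<Longrightarrow> \<eta>' x = 0" "\<And>x. dist (c j) x \<ge> 2 * r j \<Longrightarrow> \<eta>' x = 1"
    "\<And>x. norm (D' x) \<le> 16 / r j * indicator (cball (c j) (2 * r j)) x" by blast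
  have cont: "continuous_on UNIV \<eta>" "continuous_on UNIV \<eta>'"
    using \<eta>(1) \<eta>'(1) by (auto simp: gderiv_def continuous_on_eq_continuous_within intro: has_derivative_continuous)
  show ?case
  proof (rule exI[of _ "\<lambda>x. \<eta>' x * \<eta> x"], rule exI[of _ "\<lambda>x. \<eta>' x *\<^sub>R D x + \<eta> x *\<^sub>R D' x"],
      intro conjI allI impI ballI)
    show "GDERIV (\<lambda>x. \<eta>' x * \<eta> x) x :> \<eta>' x *\<^sub>R D x + \<eta> x *\<^sub>R D' x" for x
      by (rule GDERIV_mult[OF \<eta>'(1) \<eta>(1)])
    show "continuous_on UNIV (\<lambda>x. \<eta>' x *\<^sub>R D x + \<eta> x *\<^sub>R D' x)"
      by (intro continuous_intros cont \<eta>(2) \<eta>'(2))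
    show "0 \<le> \<eta>' x * \<eta> x" "\<eta>' x * \<eta> x \<le> 1" for x
      using \<eta>(3)[of x] \<eta>'(3)[of x] by (simp_all add: mult_le_one)
    show "\<eta>' x * \<eta> x = 0" if "x \<in> (\<Union>i\<in>insert j I. ball (c i) (r i))" for x
      using that \<eta>(4)[of x] \<eta>'(4)[of x] by auto
    show "\<eta>' x * \<eta> x = 1" if "\<forall>i\<in>insert j I. dist (c i) x \<ge> 2 * r i" for x
      using that \<eta>(5)[of x] \<eta>'(5)[of x] by auto
    show "norm (\<eta>' x *\<^sub>R D x + \<eta> x *\<^sub>R D' x) \<le> (\<Sum>i\<in>insert j I. 16 / r i * indicator (cball (c i) (2 * r i)) x)" for x
    proof -
      have "norm (\<eta>' x *\<^sub>R D x + \<eta> x *\<^sub>R D' x) \<le> \<eta>' x * norm (D x) + \<eta> x * norm (D' x)"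
        using norm_triangle_ineq[of "\<eta>' x *\<^sub>R D x" "\<eta> x *\<^sub>R D' x"] \<eta>(3)[of x] \<eta>'(3)[of x] by simp
      also have "\<dots> \<le> 1 * norm (D x) + 1 * norm (D' x)"
        using \<eta>(3)[of x] \<eta>'(3)[of x] by (intro add_mono mult_right_mono) auto
      also have "\<dots> \<le> (\<Sum>i\<in>insert j I. 16 / r i * indicator (cball (c i) (2 * r i)) x)"
        using \<eta>(6)[of x] \<eta>'(6)[of x] insert.hyps by simp
      finally show ?thesis .
    qed
  qed
qed

text \<open>A set of diameter d lies in every open ball about one of its points with radius above d.
  Replacing the covering sets by such balls gives an open cover, from which compactness selects
  finitely many. Centres in \<open>A\<close> keep the balls close to \<open>A\<close>.\<close>

lemma hausdorff_null_finite_cover: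
  fixes A :: "'a::euclidean_space set"
  assumes A: "compact A" "hausdorff_measure s A = 0" and "\<epsilon> > 0" "\<delta> > 0"
  obtains I :: "nat set" and c r where "finite I" "\<forall>i\<in>I. c i \<in> A \<and> 0 < r i \<and> r i < \<delta>"
    "A \<subseteq> (\<Union>i\<in>I. ball (c i) (r i))" "(\<Sum>i\<in>I. r i ^ s) < \<epsilon>"
proof -
  \<comment> \<open>All constants of \<open>hausdorff_weight\<close> are collected here: the weight
    of a nonempty set is \<open>\<omega>\<close> times a power of its diameter.\<close>
  define \<omega> where "\<omega> = unit_ball_vol (real s) / 2 ^ s"
  have \<omega>: "\<omega> > 0" by (simp add: \<omega>_def)
  \<comment> \<open>Diameters up to \<open>\<delta> / 2\<close> leave room for radii strictly
    between the diameter and \<open>\<delta>\<close>. Likewise the cover may use only half of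
    \<open>\<epsilon>\<close>, the other half being kept for the enlargement.\<close>
  have "hausdorff_premeasure s (\<delta> / 2) A \<le> hausdorff_measure s A"
    unfolding hausdorff_measure_def using \<open>\<delta> > 0\<close> by (intro SUP_upper) auto
  also have "\<dots> < ennreal (\<omega> * (\<epsilon> / 2))"
    using A(2) \<omega> \<open>\<epsilon> > 0\<close> by simp
  finally obtain C where C: "A \<subseteq> (\<Union>i. C i)" "\<And>i. bounded (C i)" "\<And>i. diameter (C i) \<le> \<delta> / 2"
    "(\<Sum>i. hausdorff_weight s (C i)) < ennreal (\<omega> * (\<epsilon> / 2))"
    unfolding hausdorff_premeasure_def INF_less_iff by blast
  have weight: "hausdorff_weight s (C i) = ennreal (\<omega> * diameter (C i) ^ s)" if "C i \<noteq> {}" for i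
    using that by (simp add: hausdorff_weight_def \<omega>_def power_divide)
  \<comment> \<open>Covering sets that miss \<open>A\<close> are dropped, since they offer no centre
    in \<open>A\<close>.\<close>
  define J where "J = {i. C i \<inter> A \<noteq> {}}"
  \<comment> \<open>A covering set may have diameter 0, so every radius is enlarged a little.\<close>
  have "\<exists>\<rho>. diameter (C i) < \<rho> \<and> \<rho> < \<delta> \<and> \<rho> ^ s < diameter (C i) ^ s + (\<epsilon> / 2) * (1 / 2) ^ Suc i" for i
  proof -
    let ?d = "diameter (C i)"
    have "((\<lambda>t::real. t ^ s) \<longlongrightarrow> ?d ^ s) (at_right ?d)"
      by (intro tendsto_intros)
    then have "\<forall>\<^sub>F t in at_right ?d. t ^ s < ?d ^ s + (\<epsilon> / 2) * (1 / 2) ^ Suc i"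
      by (rule order_tendstoD) (use \<open>\<epsilon> > 0\<close> in simp)
    moreover have "\<forall>\<^sub>F t in at_right ?d. t \<in> {?d<..<\<delta>}"
      using C(3)[of i] \<open>\<delta> > 0\<close> by (intro eventually_at_right_real) linarith
    ultimately have "\<forall>\<^sub>F t in at_right ?d. ?d < t \<and> t < \<delta> \<and> t ^ s < ?d ^ s + (\<epsilon> / 2) * (1 / 2) ^ Suc i"
      by eventually_elim auto
    then show ?thesis
      using eventually_happens'[OF trivial_limit_at_right_real] by blast
  qed
  then obtain r where r: "\<And>i. diameter (C i) < r i" "\<And>i. r i < \<delta>"
    "\<And>i. r i ^ s < diameter (C i) ^ s + (\<epsilon> / 2) * (1 / 2) ^ Suc i"
    by metis
  define c where "c i = (SOME a. a \<in> C i \<inter> A)" for i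
  have c: "c i \<in> C i \<inter> A" if "i \<in> J" for i
    unfolding c_def by (rule someI_ex) (use that in \<open>auto simp: J_def\<close>)
  have "A \<subseteq> (\<Union>i\<in>J. ball (c i) (r i))"
  proof
    fix x assume "x \<in> A"
    then obtain i where i: "x \<in> C i" "i \<in> J" using C(1) unfolding J_def by blast
    then have "dist (c i) x \<le> diameter (C i)"
      using c[OF i(2)] by (intro diameter_bounded_bound C(2)) auto
    then show "x \<in> (\<Union>i\<in>J. ball (c i) (r i))"
      using r(1)[of i] i(2) by force
  qed
  then obtain I where I: "I \<subseteq> J" "finite I" "A \<subseteq> (\<Union>i\<in>I. ball (c i) (r i))"
    using compactE_image[OF A(1), of J "\<lambda>i. ball (c i) (r i)"] by (metis open_ball)
  have d: "(\<Sum>i\<in>I. diameter (C i) ^ s) < \<epsilon> / 2"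
  proof -
    have "ennreal (\<omega> * (\<Sum>i\<in>I. diameter (C i) ^ s)) = (\<Sum>i\<in>I. ennreal (\<omega> * diameter (C i) ^ s))"
      using \<omega> by (simp add: sum_distrib_left diameter_ge_0[OF C(2)] sum_ennreal)
    also have "\<dots> = (\<Sum>i\<in>I. hausdorff_weight s (C i))"
      using I(1) by (intro sum.cong refl weight[symmetric]) (auto simp: J_def)
    also have "\<dots> \<le> (\<Sum>i. hausdorff_weight s (C i))"
      using I(2) by (intro sum_le_suminf) auto
    also have "\<dots> < ennreal (\<omega> * (\<epsilon> / 2))" by (rule C(4))
    finally have "\<omega> * (\<Sum>i\<in>I. diameter (C i) ^ s) < \<omega> * (\<epsilon> / 2)"
      using \<omega> \<open>\<epsilon> > 0\<close> by (subst (asm) ennreal_less_iff) (auto intro!: mult_nonneg_nonneg sum_nonneg simp: diameter_ge_0[OF C(2)])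
    then show ?thesis using \<omega> by simp
  qed
  \<comment> \<open>The geometric weights make the total enlargement at most
    \<open>\<epsilon> / 2\<close>, whichever finite set of indices was selected.\<close>
  have g: "(\<Sum>i\<in>I. (1 / 2 :: real) ^ Suc i) \<le> 1"
    using sum_le_suminf[of "\<lambda>i. (1 / 2 :: real) ^ Suc i" I] power_half_series I(2)
    by (auto simp: sums_iff)
  have "(\<Sum>i\<in>I. r i ^ s) \<le> (\<Sum>i\<in>I. diameter (C i) ^ s + (\<epsilon> / 2) * (1 / 2) ^ Suc i)"
    by (intro sum_mono less_imp_le r)
  also have "\<dots> = (\<Sum>i\<in>I. diameter (C i) ^ s) + (\<epsilon> / 2) * (\<Sum>i\<in>I. (1 / 2) ^ Suc i)"
    by (simp only: sum.distrib sum_distrib_left)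
  also have "\<dots> < \<epsilon> / 2 + (\<epsilon> / 2) * 1"
    using d g \<open>\<epsilon> > 0\<close> by (intro add_less_le_mono mult_left_mono) auto
  finally have "(\<Sum>i\<in>I. r i ^ s) < \<epsilon>" by simp
  moreover have "c i \<in> A \<and> 0 < r i \<and> r i < \<delta>" if "i \<in> I" for i
    using that I(1) c r(1,2)[of i] diameter_ge_0[OF C(2), of i] by force
  ultimately show thesis
    using that I(2,3) by blast
qed

text \<open>For radii below 1, \<open>r ^ Suc s\<close> is at most \<open>r ^ s\<close>, so the
  volume of the covering balls is controlled by the sum that can be made small.\<close>

lemma hausdorff_null_imp_null:
  fixes A :: "'a::euclidean_space set"
  assumes A: "compact A" "hausdorff_measure s A = 0" and s: "DIM('a) = Suc s"
  shows "A \<in> null_sets lborel"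
proof -
  have "emeasure lborel A \<le> ennreal e" if "e > 0" for e
  proof -
    define \<omega> where "\<omega> = unit_ball_vol (real DIM('a))"
    have \<omega>: "\<omega> > 0" by (simp add: \<omega>_def)
    obtain I :: "nat set" and c r where I: "finite I" "\<forall>i\<in>I. c i \<in> A \<and> 0 < r i \<and> r i < 1"
      "A \<subseteq> (\<Union>i\<in>I. ball (c i) (r i))" "(\<Sum>i\<in>I. r i ^ s) < e / \<omega>"
      by (rule hausdorff_null_finite_cover[OF A divide_pos_pos[OF \<open>e > 0\<close> \<omega>] zero_less_one])
    have "emeasure lborel A \<le> emeasure lborel (\<Union>i\<in>I. ball (c i) (r i))"
      using I(3) by (intro emeasure_mono) auto
    also have "\<dots> \<le> (\<Sum>i\<in>I. emeasure lborel (ball (c i) (r i)))"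
      using I(1) by (intro emeasure_subadditive_finite) auto
    also have "\<dots> = (\<Sum>i\<in>I. ennreal (\<omega> * r i ^ DIM('a)))"
      using I(2) by (intro sum.cong) (auto simp: emeasure_ball \<omega>_def less_imp_le)
    also have "\<dots> \<le> (\<Sum>i\<in>I. ennreal (\<omega> * r i ^ s))"
      using I(2) \<omega> unfolding s by (intro sum_mono ennreal_leI mult_left_mono power_decreasing) (auto simp: less_imp_le)
    also have "\<dots> = ennreal (\<omega> * (\<Sum>i\<in>I. r i ^ s))"
      using I(2) \<omega> by (subst sum_ennreal) (auto simp: less_imp_le sum_distrib_left)
    also have "\<dots> \<le> ennreal e"
      using I(4) \<omega> by (intro ennreal_leI) (simp add: field_simps)
    finally show ?thesis .
  qed
  then have "emeasure lborel A = 0"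
    by (metis ennreal_le_epsilon le_zero_eq add_0)
  then show ?thesis
    using A(1) by (intro null_setsI) (auto intro: borel_compact)
qed

text \<open>One parameter \<open>\<epsilon>\<close> governs both the distance from \<open>A\<close>
  beyond which \<open>\<eta>\<close> is 1 and the integral of the gradient. Radii below
  \<open>\<epsilon> / 2\<close> with centres in \<open>A\<close> ensure the former, since
  \<open>\<eta>\<close> is 1 off the doubled balls.\<close>

lemma hausdorff_null_cutoff:
  fixes A :: "'a::euclidean_space set"
  assumes A: "compact A" "hausdorff_measure s A = 0" and s: "DIM('a) = Suc s" and "\<epsilon> > 0"
  shows "\<exists>T \<eta> D. open T \<and> A \<subseteq> T \<and> (\<forall>x\<in>T. \<eta> x = 0) \<and> (\<forall>x. GDERIV \<eta> x :> D x) \<and>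
    continuous_on UNIV D \<and> (\<forall>x. 0 \<le> \<eta> x \<and> \<eta> x \<le> (1::real)) \<and>
    (\<forall>x. (\<forall>a\<in>A. dist a x \<ge> \<epsilon>) \<longrightarrow> \<eta> x = 1) \<and>
    integrable lborel (\<lambda>x. norm (D x)) \<and> (LINT x|lborel. norm (D x)) \<le> \<epsilon>"
proof -
  define \<omega> where "\<omega> = unit_ball_vol (real DIM('a))"
  have \<omega>: "\<omega> > 0" by (simp add: \<omega>_def)
  \<comment> \<open>A ball contributes at most \<open>16 / r\<close> times the volume
    \<open>\<omega> * (2 * r) ^ Suc s\<close> of its double, which is
    \<open>M * r ^ s\<close>.\<close>
  define M where "M = 16 * \<omega> * 2 ^ Suc s"
  have M: "M > 0" using \<omega> by (simp add: M_def)
  obtain I :: "nat set" and c r where I: "finite I" "\<forall>i\<in>I. c i \<in> A \<and> 0 < r i \<and> r i < \<epsilon> / 2"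
    "A \<subseteq> (\<Union>i\<in>I. ball (c i) (r i))" "(\<Sum>i\<in>I. r i ^ s) < \<epsilon> / M"
    by (rule hausdorff_null_finite_cover[OF A divide_pos_pos[OF \<open>\<epsilon> > 0\<close> M] half_gt_zero[OF \<open>\<epsilon> > 0\<close>]])
  have "\<exists>\<eta> D. (\<forall>x. GDERIV \<eta> x :> D x) \<and> continuous_on UNIV D \<and> (\<forall>x. 0 \<le> \<eta> x \<and> \<eta> x \<le> (1::real)) \<and>
    (\<forall>x\<in>(\<Union>i\<in>I. ball (c i) (r i)). \<eta> x = 0) \<and>
    (\<forall>x. (\<forall>i\<in>I. dist (c i) x \<ge> 2 * r i) \<longrightarrow> \<eta> x = 1) \<and>
    (\<forall>x. norm (D x) \<le> (\<Sum>i\<in>I. 16 / r i * indicator (cball (c i) (2 * r i)) x))"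
    using I(2) by (intro finite_balls_cutoff I(1)) blast
  then obtain \<eta> D where "(\<forall>x. GDERIV \<eta> x :> D x) \<and> continuous_on UNIV D \<and> (\<forall>x. 0 \<le> \<eta> x \<and> \<eta> x \<le> (1::real)) \<and>
    (\<forall>x\<in>(\<Union>i\<in>I. ball (c i) (r i)). \<eta> x = 0) \<and>
    (\<forall>x. (\<forall>i\<in>I. dist (c i) x \<ge> 2 * r i) \<longrightarrow> \<eta> x = 1) \<and>
    (\<forall>x. norm (D x) \<le> (\<Sum>i\<in>I. 16 / r i * indicator (cball (c i) (2 * r i)) x))"
    by (elim exE)
  then have \<eta>: "\<And>x. GDERIV \<eta> x :> D x" "continuous_on UNIV D" "\<And>x. 0 \<le> \<eta> x \<and> \<eta> x \<le> (1::real)"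
    "\<And>x. x \<in> (\<Union>i\<in>I. ball (c i) (r i)) \<Longrightarrow> \<eta> x = 0"
    "\<And>x. \<forall>i\<in>I. dist (c i) x \<ge> 2 * r i \<Longrightarrow> \<eta> x = 1"
    "\<And>x. norm (D x) \<le> (\<Sum>i\<in>I. 16 / r i * indicator (cball (c i) (2 * r i)) x)"
    by blast+
  let ?b = "\<lambda>x. \<Sum>i\<in>I. 16 / r i * indicator (cball (c i) (2 * r i)) x"
  have ib: "integrable lborel (\<lambda>x. 16 / r i * indicator (cball (c i) (2 * r i)) x)" for i
    by (intro integrable_mult_right integrable_real_indicator) (use emeasure_bounded_finite[OF bounded_cball] in auto)
  then have ib': "integrable lborel ?b"
    by (intro Bochner_Integration.integrable_sum)
  show ?thesis
  proof (rule exI[of _ "\<Union>i\<in>I. ball (c i) (r i)"], rule exI[of _ \<eta>], rule exI[of _ D], intro conjI allI impI)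
    show "\<eta> x = 1" if "\<forall>a\<in>A. dist a x \<ge> \<epsilon>" for x
    proof (intro \<eta>(5) ballI)
      show "dist (c i) x \<ge> 2 * r i" if "i \<in> I" for i
        using bspec[OF I(2) that] bspec[OF \<open>\<forall>a\<in>A. dist a x \<ge> \<epsilon>\<close>, of "c i"] by linarith
    qed
    show iD: "integrable lborel (\<lambda>x. norm (D x))"
      by (rule Bochner_Integration.integrable_bound[OF ib'])
        (use \<eta>(6) borel_measurable_continuous_onI[OF \<eta>(2)] in \<open>auto intro!: AE_I2 order_trans[OF \<eta>(6)]\<close>)
    have "(LINT x|lborel. norm (D x)) \<le> (LINT x|lborel. ?b x)"
      by (rule integral_mono[OF iD ib' \<eta>(6)])
    also have "\<dots> = (\<Sum>i\<in>I. 16 / r i * (\<omega> * (2 * r i) ^ Suc s))"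
      using I(2) by (subst Bochner_Integration.integral_sum[OF ib])
        (auto intro!: sum.cong simp: content_cball \<omega>_def s less_imp_le)
    also have "\<dots> = M * (\<Sum>i\<in>I. r i ^ s)"
      unfolding sum_distrib_left
    proof (rule sum.cong)
      fix i assume "i \<in> I"
      then have "r i > 0" using I(2) by blast
      then show "16 / r i * (\<omega> * (2 * r i) ^ Suc s) = M * r i ^ s"
        by (simp add: M_def power_mult_distrib field_simps)
    qed simp
    also have "\<dots> \<le> \<epsilon>" using I(4) M by (simp add: field_simps)
    finally show "(LINT x|lborel. norm (D x)) \<le> \<epsilon>" .
  qed (use \<eta> I in auto)
qed

section \<open>The divergence theorem across removable sets\<close>

text \<open>Measurability of \<open>g\<close> comes from the completeness of
  \<open>lebesgue\<close>. This allows integrands built from an arbitrary representative of a weak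
  gradient.\<close>

lemma integrable_lebesgue_AE_cong:
  fixes f g :: "'a::euclidean_space \<Rightarrow> 'b::euclidean_space"
  assumes "integrable lebesgue f" "AE x in lebesgue. f x = g x"
  shows "integrable lebesgue g" "integral\<^sup>L lebesgue g = integral\<^sup>L lebesgue f"
proof -
  have g: "g \<in> borel_measurable lebesgue"
    using borel_measurable_AE[OF _ assms(2)] assms(1) by auto
  show "integrable lebesgue g"
    by (rule integrable_cong_AE_imp[OF assms(1) g]) (use assms(2) in auto)
  show "integral\<^sup>L lebesgue g = integral\<^sup>L lebesgue f"
    by (rule integral_cong_AE) (use assms g in auto)
qed

lemma integrable_lborel_imp_lebesgue:
  fixes f :: "'a::euclidean_space \<Rightarrow> 'b::euclidean_space"
  assumes "integrable lborel f"
  shows "integrable lebesgue f" "integral\<^sup>L lebesgue f = integral\<^sup>L lborel f"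
  using assms integrable_completion[of f lborel] integral_completion[of f lborel] by auto

lemma integrable_L1_loc_mult:
  fixes G :: "'a::euclidean_space \<Rightarrow> 'b::euclidean_space" and \<phi> :: "'a \<Rightarrow> real"
  assumes G: "L1_loc \<Omega> G" and K: "compact K" "K \<subseteq> \<Omega>"
    and \<phi>: "continuous_on UNIV \<phi>" "\<And>x. x \<notin> K \<Longrightarrow> \<phi> x = 0"
  shows "integrable lebesgue (\<lambda>x. \<phi> x *\<^sub>R G x)" "set_integrable lebesgue \<Omega> (\<lambda>x. \<phi> x *\<^sub>R G x)"
proof -
  have i: "integrable lebesgue (\<lambda>x. indicator K x *\<^sub>R G x)"
    using G K by (simp add: L1_loc_def set_integrable_def)
  have "bounded (\<phi> ` K)"
    by (intro compact_imp_bounded compact_continuous_image K continuous_on_subset[OF \<phi>(1)]) auto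
  then obtain M where M: "\<And>x. x \<in> K \<Longrightarrow> norm (\<phi> x) \<le> M" "M > 0"
    unfolding bounded_pos by auto
  have m: "\<phi> \<in> borel_measurable lebesgue"
    using borel_measurable_continuous_onI[OF \<phi>(1)] by (intro measurable_completion) auto
  have "integrable lebesgue (\<lambda>x. \<phi> x *\<^sub>R (indicator K x *\<^sub>R G x))"
  proof (rule Bochner_Integration.integrable_bound)
    show "integrable lebesgue (\<lambda>x. M * norm (indicator K x *\<^sub>R G x))"
      by (intro integrable_mult_right integrable_norm i)
    show "(\<lambda>x. \<phi> x *\<^sub>R (indicator K x *\<^sub>R G x)) \<in> borel_measurable lebesgue"
      by (intro borel_measurable_scaleR m borel_measurable_integrable[OF i])
    show "AE x in lebesgue. norm (\<phi> x *\<^sub>R (indicator K x *\<^sub>R G x)) \<le> norm (M * norm (indicator K x *\<^sub>R G x))"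
      using M by (auto intro!: AE_I2 mult_right_mono simp: indicator_def)
  qed
  moreover have "(\<lambda>x. \<phi> x *\<^sub>R (indicator K x *\<^sub>R G x)) = (\<lambda>x. \<phi> x *\<^sub>R G x)"
    using \<phi>(2) by (auto simp: indicator_def fun_eq_iff)
  ultimately show 1: "integrable lebesgue (\<lambda>x. \<phi> x *\<^sub>R G x)" by simp
  have "(\<lambda>x. indicator \<Omega> x *\<^sub>R (\<phi> x *\<^sub>R G x)) = (\<lambda>x. \<phi> x *\<^sub>R G x)"
    using \<phi>(2) K(2) by (auto simp: indicator_def fun_eq_iff)
  with 1 show "set_integrable lebesgue \<Omega> (\<lambda>x. \<phi> x *\<^sub>R G x)" by (simp add: set_integrable_def)
qed

section \<open>Hausdorff null sets inside an open set\<close>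

lemma hausdorff_measure_mono: "A \<subseteq> B \<Longrightarrow> hausdorff_measure s A \<le> hausdorff_measure s B"
  unfolding hausdorff_measure_def hausdorff_premeasure_def
  by (intro SUP_mono' INF_superset_mono) auto

lemma hausdorff_null_subset: "hausdorff_measure s B = 0 \<Longrightarrow> A \<subseteq> B \<Longrightarrow> hausdorff_measure s A = 0"
  using hausdorff_measure_mono[of A B s] by simp

text \<open>The covering argument is for compact sets. Openness of \<open>\<Omega> - S\<close> makes
  the trace of \<open>S\<close> on each member of a compact exhaustion of \<open>\<Omega>\<close>
  compact, and countably many null sets are null together.\<close>

lemma hausdorff_null_imp_negligible:
  fixes S :: "'a::euclidean_space set"
  assumes "open \<Omega>" "S \<subseteq> \<Omega>" "open (\<Omega> - S)" "hausdorff_measure s S = 0" "DIM('a) = Suc s"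
  shows "negligible S"
proof -
  obtain C where C: "\<And>n::nat. compact (C n)" "\<And>n. C n \<subseteq> \<Omega>" "(\<Union>n. C n) = \<Omega>"
    using open_Union_compact_subsets[OF assms(1)] by metis
  have "negligible (C n \<inter> S)" for n
  proof -
    have "C n \<inter> S = C n - (\<Omega> - S)" using C(2) by blast
    then have "compact (C n \<inter> S)" using C(1) assms(3) by (simp add: compact_diff)
    then have "C n \<inter> S \<in> null_sets lborel"
      by (rule hausdorff_null_imp_null[OF _ hausdorff_null_subset[OF assms(4)] assms(5)]) auto
    then show ?thesis
      by (simp add: negligible_iff_null_sets null_sets_completionI)
  qed
  then have "negligible (\<Union>n. C n \<inter> S)" by (intro negligible_countable_Union) auto
  moreover have "(\<Union>n. C n \<inter> S) = S" using C(3) assms(2) by blast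
  ultimately show ?thesis by simp
qed

text \<open>The integral of \<open>\<eta> n * w\<close> is treated in two ways: integration by parts
  on \<open>\<Omega> - S\<close> bounds it by a constant over n + 1, and dominated convergence with
  majorant \<open>norm (w x)\<close> sends it to the integral of \<open>w\<close>, which is
  therefore 0.\<close>

lemma divergence_theorem_removable:
  fixes V :: "'a::euclidean_space \<Rightarrow> 'a"
  assumes s: "DIM('a) = Suc s" and \<Omega>: "open \<Omega>" "S \<subseteq> \<Omega>" "open (\<Omega> - S)"
    and S: "hausdorff_measure s S = 0"
    and V: "\<And>x. x \<in> \<Omega> - S \<Longrightarrow> V differentiable at x"
      "\<And>b. continuous_on (\<Omega> - S) (\<lambda>x. frechet_derivative V (at x) b)"
      "\<And>x. norm (V x) \<le> 1" "\<And>x. x \<in> \<Omega> - S \<Longrightarrow> divergence V x = H x"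
    and H: "L1_loc \<Omega> H"
    and \<phi>: "\<And>x. GDERIV \<phi> x :> D x" "continuous_on UNIV D" "\<And>x. x \<notin> K \<Longrightarrow> \<phi> x = 0"
    and K: "compact K" "K \<subseteq> \<Omega>"
  shows "set_integrable lebesgue \<Omega> (\<lambda>x. V x \<bullet> D x)"
    "(LINT x:\<Omega>|lebesgue. V x \<bullet> D x) + (LINT x:\<Omega>|lebesgue. H x * \<phi> x) = 0"
proof -
  let ?U = "\<Omega> - S"
  have D0: "D x = 0" if "x \<notin> K" for x
    by (rule gradient_eq_0_outside[OF \<phi>(1) K(1) \<phi>(3) that])
  have c\<phi>: "continuous_on UNIV \<phi>"
    using \<phi>(1) by (auto simp: gderiv_def continuous_on_eq_continuous_within intro: has_derivative_continuous)
  have "bounded (\<phi> ` K)"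
    by (intro compact_imp_bounded compact_continuous_image K continuous_on_subset[OF c\<phi>]) auto
  then obtain M where M0: "\<And>x. x \<in> K \<Longrightarrow> norm (\<phi> x) \<le> M" "M > 0"
    unfolding bounded_pos by auto
  have M: "\<bar>\<phi> x\<bar> \<le> M" for x
    using M0 \<phi>(3)[of x] by (cases "x \<in> K") auto
  have nS: "AE x in lebesgue. x \<notin> S"
    using hausdorff_null_imp_negligible[OF \<Omega> S s] by (simp add: negligible_iff_null_sets AE_not_in)
  \<comment> \<open>On \<open>S\<close> the field \<open>V\<close> is arbitrary apart from its norm
    bound; cut off to the open set where it is continuous, it is Borel.\<close>
  have mV: "(\<lambda>x. indicator ?U x *\<^sub>R V x) \<in> borel_measurable borel"
    using V(1) \<Omega>(3)
    by (intro borel_measurable_continuous_on_indicator)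
      (auto intro!: continuous_at_imp_continuous_on differentiable_imp_continuous_within)
  define g where "g x = indicator ?U x *\<^sub>R (V x \<bullet> D x)" for x
  have g': "g x = (indicator ?U x *\<^sub>R V x) \<bullet> D x" for x
    by (simp add: g_def)
  have mg: "g \<in> borel_measurable borel"
    unfolding g' using mV borel_measurable_continuous_onI[OF \<phi>(2)] by measurable
  have iD: "integrable lborel (\<lambda>x. norm (D x))"
    by (intro integrable_norm integrable_compact_support[OF \<phi>(2) K(1)] D0)
  have "integrable lborel g"
  proof (rule Bochner_Integration.integrable_bound[OF iD])
    have "norm (g x) \<le> norm (D x)" for x
    proof -
      have "\<bar>V x \<bullet> D x\<bar> \<le> norm (V x) * norm (D x)" by (rule Cauchy_Schwarz_ineq2)
      also have "\<dots> \<le> 1 * norm (D x)" by (intro mult_right_mono V(3)) auto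
      finally show ?thesis by (auto simp: g_def indicator_def)
    qed
    then show "AE x in lborel. norm (g x) \<le> norm (norm (D x))" by auto
  qed (use mg in auto)
  then have ig: "integrable lebesgue g" by (rule integrable_lborel_imp_lebesgue)
  have gV: "AE x in lebesgue. g x = indicator \<Omega> x *\<^sub>R (V x \<bullet> D x)"
    using nS by eventually_elim (auto simp: g_def indicator_def)
  show "set_integrable lebesgue \<Omega> (\<lambda>x. V x \<bullet> D x)"
    unfolding set_integrable_def by (rule integrable_lebesgue_AE_cong[OF ig gV])
  define k where "k x = \<phi> x * H x" for x
  have ik: "integrable lebesgue k"
    using integrable_L1_loc_mult(1)[OF H K c\<phi>] \<phi>(3) by (simp add: k_def[abs_def])
  \<comment> \<open>Only the singular points in the support matter. They form a compact set, being
    \<open>K\<close> minus the open set of regular points.\<close>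
  define A where "A = K \<inter> S"
  have "A = K - ?U" using K(2) by (auto simp: A_def)
  then have cA: "compact A" using K(1) \<Omega>(3) by (simp add: compact_diff)
  have hA: "hausdorff_measure s A = 0"
    by (rule hausdorff_null_subset[OF S]) (auto simp: A_def)
  define P where "P n T \<eta> E \<longleftrightarrow> open T \<and> A \<subseteq> T \<and> (\<forall>x\<in>T. \<eta> x = 0) \<and> (\<forall>x. GDERIV \<eta> x :> E x) \<and>
      continuous_on UNIV E \<and> (\<forall>x. 0 \<le> \<eta> x \<and> \<eta> x \<le> (1::real)) \<and>
      (\<forall>x. (\<forall>a\<in>A. dist a x \<ge> inverse (real (Suc n))) \<longrightarrow> \<eta> x = 1) \<and>
      integrable lborel (\<lambda>x. norm (E x)) \<and> (LINT x|lborel. norm (E x)) \<le> inverse (real (Suc n))" for n T \<eta> E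
  have "\<exists>T \<eta> E. P n T \<eta> E" for n
    unfolding P_def by (rule hausdorff_null_cutoff[OF cA hA s]) simp
  then obtain T \<eta> E where "\<And>n. P n (T n) (\<eta> n) (E n)"
    by metis
  then have cut: "\<And>n. open (T n)" "\<And>n. A \<subseteq> T n" "\<And>n x. x \<in> T n \<Longrightarrow> \<eta> n x = 0"
    "\<And>n x. GDERIV (\<eta> n) x :> E n x" "\<And>n. continuous_on UNIV (E n)" "\<And>n x. 0 \<le> \<eta> n x \<and> \<eta> n x \<le> (1::real)"
    "\<And>n x. \<forall>a\<in>A. dist a x \<ge> inverse (real (Suc n)) \<Longrightarrow> \<eta> n x = 1"
    "\<And>n. integrable lborel (\<lambda>x. norm (E n x))" "\<And>n. (LINT x|lborel. norm (E n x)) \<le> inverse (real (Suc n))"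
    unfolding P_def by blast+
  have c\<eta>: "continuous_on UNIV (\<eta> n)" for n
    using cut(4) by (auto simp: gderiv_def continuous_on_eq_continuous_within intro: has_derivative_continuous)
  \<comment> \<open>This is the integrand of the claimed identity, set to 0 on \<open>S\<close>,
    where the cutoffs need not tend to 1.\<close>
  define w where "w x = indicator ?U x *\<^sub>R (g x + k x)" for x
  have U_meas: "?U \<in> sets lebesgue" using \<Omega>(3) by (intro sets_completionI_sets) auto
  have iw: "integrable lebesgue w"
    unfolding w_def by (intro integrable_mult_indicator U_meas Bochner_Integration.integrable_add ig ik)
  have est: "\<bar>LINT x|lebesgue. \<eta> n x * w x\<bar> \<le> M * inverse (real (Suc n))" for n
  proof -
    let ?D = "\<lambda>x. \<phi> x *\<^sub>R E n x + \<eta> n x *\<^sub>R D x"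
    \<comment> \<open>Off this set \<open>\<phi>\<close> or \<open>\<eta> n\<close> vanishes, and it
      avoids \<open>S\<close> because \<open>T n\<close> contains \<open>A\<close>. Hence the
      product has compact support in the region where \<open>V\<close> is C^1.\<close>
    have L: "compact (K - T n)" "K - T n \<subseteq> ?U"
      using K cut(1,2)[of n] by (auto simp: compact_diff A_def)
    have \<psi>0: "\<phi> x * \<eta> n x = 0" if "x \<notin> K - T n" for x
      using that \<phi>(3)[of x] cut(3)[of x n] by auto
    have c: "continuous_on UNIV ?D"
      by (intro continuous_intros c\<phi> c\<eta> cut(5) \<phi>(2))
    have D\<psi>: "?D x = 0" if "x \<notin> K - T n" for x
      by (rule gradient_eq_0_outside[OF GDERIV_mult[OF \<phi>(1) cut(4)] L(1) _ that]) (rule \<psi>0)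
    have ibp: "integrable lborel (\<lambda>x. V x \<bullet> ?D x)" "integrable lborel (\<lambda>x. \<phi> x * \<eta> n x * divergence V x)"
      "(LINT x|lborel. V x \<bullet> ?D x) = - (LINT x|lborel. \<phi> x * \<eta> n x * divergence V x)"
      by (rule integral_inner_gradient_divergence[OF \<Omega>(3) L GDERIV_mult[OF \<phi>(1) cut(4)] c _ V(1,2)];
          (rule \<psi>0)?; assumption)+
    note ibp' = integrable_lborel_imp_lebesgue[OF ibp(1)] integrable_lborel_imp_lebesgue[OF ibp(2)]
    let ?r = "\<lambda>x. \<phi> x * ((indicator ?U x *\<^sub>R V x) \<bullet> E n x)"
    \<comment> \<open>The error of cutting out \<open>S\<close> is the integral of \<open>\<phi> V \<bullet> \<nabla>\<eta>\<close>, at most \<open>sup |\<phi>|\<close> times the integral of \<open>|\<nabla>\<eta>|\<close>.\<close>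
    have ptw: "\<eta> n x * w x = V x \<bullet> ?D x + \<phi> x * \<eta> n x * divergence V x - ?r x" for x
    proof (cases "x \<in> ?U")
      case True
      then show ?thesis
        using V(4)[OF True] by (simp add: w_def g_def k_def inner_add_right algebra_simps)
    next
      case False
      then have "x \<notin> K - T n" using L by auto
      then show ?thesis using False \<psi>0[of x] D\<psi>[of x] by (simp add: w_def)
    qed
    have rb: "norm (?r x) \<le> M * norm (E n x)" for x
    proof -
      have "\<bar>(indicator ?U x *\<^sub>R V x) \<bullet> E n x\<bar> \<le> norm (indicator ?U x *\<^sub>R V x) * norm (E n x)"
        by (rule Cauchy_Schwarz_ineq2)
      also have "\<dots> \<le> 1 * norm (E n x)"
        using V(3)[of x] by (intro mult_right_mono) (auto simp: indicator_def)
      finally have "\<bar>\<phi> x\<bar> * \<bar>(indicator ?U x *\<^sub>R V x) \<bullet> E n x\<bar> \<le> M * (1 * norm (E n x))"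
        using M0(2) by (intro mult_mono M) auto
      then show ?thesis by (simp add: abs_mult)
    qed
    have iM: "integrable lborel (\<lambda>x. M * norm (E n x))"
      by (intro integrable_mult_right cut(8))
    have "?r \<in> borel_measurable borel"
      using mV borel_measurable_continuous_onI[OF c\<phi>] borel_measurable_continuous_onI[OF cut(5)[of n]]
      by measurable
    then have ir: "integrable lborel ?r"
      by (intro Bochner_Integration.integrable_bound[OF iM]) (use rb order_trans[OF rb abs_ge_self] in auto)
    have "(LINT x|lebesgue. \<eta> n x * w x) = - (LINT x|lborel. ?r x)"
      unfolding ptw using ibp(3) ibp' integrable_lborel_imp_lebesgue[OF ir]
      by (subst Bochner_Integration.integral_diff Bochner_Integration.integral_add; simp)+
    then have "\<bar>LINT x|lebesgue. \<eta> n x * w x\<bar> \<le> (LINT x|lborel. norm (?r x))"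
      using integral_norm_bound[of lborel ?r] by simp
    also have "\<dots> \<le> (LINT x|lborel. M * norm (E n x))"
      by (intro integral_mono integrable_norm ir iM rb)
    also have "\<dots> \<le> M * inverse (real (Suc n))"
      using cut(9)[of n] M0(2) by simp
    finally show ?thesis .
  qed
  have "(\<lambda>n. M * inverse (real (Suc n))) \<longlonglongrightarrow> M * 0"
    by (intro tendsto_mult tendsto_const LIMSEQ_inverse_real_of_nat)
  then have lim: "(\<lambda>n. M * inverse (real (Suc n))) \<longlonglongrightarrow> 0"
    by (simp only: mult_zero_right)
  have "(\<lambda>n. LINT x|lebesgue. \<eta> n x * w x) \<longlonglongrightarrow> 0"
    by (rule Lim_null_comparison[OF _ lim]) (unfold real_norm_def, rule always_eventually, rule allI, rule est)
  moreover have "(\<lambda>n. LINT x|lebesgue. \<eta> n x * w x) \<longlonglongrightarrow> (LINT x|lebesgue. w x)"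
  proof (rule integral_dominated_convergence[where w="\<lambda>x. norm (w x)"])
    show "w \<in> borel_measurable lebesgue" "integrable lebesgue (\<lambda>x. norm (w x))"
      using iw by auto
    show "(\<lambda>x. \<eta> n x * w x) \<in> borel_measurable lebesgue" for n
    proof (rule borel_measurable_times)
      show "\<eta> n \<in> borel_measurable lebesgue"
        using borel_measurable_continuous_onI[OF c\<eta>[of n]] by (intro measurable_completion) auto
    qed (use iw in auto)
    show "AE x in lebesgue. norm (\<eta> n x * w x) \<le> norm (w x)" for n
      using cut(6)[of n] by (auto intro!: AE_I2 mult_left_le_one_le simp: abs_mult)
    \<comment> \<open>A regular point has positive distance from the closed set \<open>A\<close>, so
      all but finitely many cutoffs equal 1 there; at all other points \<open>w\<close> is
      0.\<close>
    have "(\<lambda>n. \<eta> n x * w x) \<longlonglongrightarrow> w x" for x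
    proof (cases "x \<in> ?U")
      case True
      then have "x \<in> - A" by (auto simp: A_def)
      moreover have "open (- A)" using cA by (simp add: compact_imp_closed open_Compl)
      ultimately obtain e where e: "e > 0" "ball x e \<subseteq> - A"
        using open_contains_ball by blast
      have "\<forall>\<^sub>F n in sequentially. inverse (real (Suc n)) < e"
        using order_tendstoD(2)[OF LIMSEQ_inverse_real_of_nat e(1)] .
      then have "\<forall>\<^sub>F n in sequentially. \<eta> n x * w x = w x"
      proof eventually_elim
        case (elim n)
        have "\<forall>a\<in>A. dist a x \<ge> inverse (real (Suc n))"
        proof
          fix a assume "a \<in> A"
          then have "a \<notin> ball x e" using e(2) by blast
          then show "dist a x \<ge> inverse (real (Suc n))" using elim by (simp add: dist_commute)
        qed
        then show ?case using cut(7) by simp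
      qed
      then show ?thesis by (rule tendsto_eventually)
    qed (simp add: w_def)
    then show "AE x in lebesgue. (\<lambda>n. \<eta> n x * w x) \<longlonglongrightarrow> w x" by simp
  qed
  ultimately have w0: "(LINT x|lebesgue. w x) = 0"
    using LIMSEQ_unique by blast
  have "AE x in lebesgue. w x = indicator \<Omega> x *\<^sub>R (V x \<bullet> D x) + indicator \<Omega> x *\<^sub>R (H x * \<phi> x)"
    using nS by eventually_elim (auto simp: w_def g_def k_def indicator_def)
  from integrable_lebesgue_AE_cong(2)[OF iw this]
  have "(LINT x|lebesgue. indicator \<Omega> x *\<^sub>R (V x \<bullet> D x) + indicator \<Omega> x *\<^sub>R (H x * \<phi> x)) = 0"
    using w0 by simp
  moreover have "integrable lebesgue (\<lambda>x. indicator \<Omega> x *\<^sub>R (V x \<bullet> D x))"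
    by (rule integrable_lebesgue_AE_cong[OF ig gV])
  moreover have "integrable lebesgue (\<lambda>x. indicator \<Omega> x *\<^sub>R (H x * \<phi> x))"
    using integrable_L1_loc_mult(2)[OF H K c\<phi>] \<phi>(3) by (simp add: set_integrable_def mult.commute)
  ultimately show "(LINT x:\<Omega>|lebesgue. V x \<bullet> D x) + (LINT x:\<Omega>|lebesgue. H x * \<phi> x) = 0"
    unfolding set_lebesgue_integral_def by simp
qed

section \<open>Smooth test functions and the fundamental lemma\<close>

text \<open>
  Every derivative of \<open>exp (- 1 / t)\<close> is a linear combination of the functions \<open>flat k\<close>, so
  smoothness needs no further functions.
\<close>

definition flat :: "nat \<Rightarrow> real \<Rightarrow> real" where
  "flat k t = (if t > 0 then inverse t ^ k * exp (- inverse t) else 0)"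

text \<open>From the right, the substitution of 1/t turns the claim into the decay of a power
  divided by the exponential at infinity.\<close>

lemma flat_tendsto_0: "(flat k \<longlongrightarrow> 0) (at 0)"
proof (rule filterlim_split_at)
  show "(flat k \<longlongrightarrow> 0) (at_left 0)"
    by (rule tendsto_eventually) (auto simp: flat_def eventually_at_filter)
  have "((\<lambda>t. inverse t ^ k / exp (inverse t)) \<longlongrightarrow> 0) (at_right (0::real))"
    by (rule filterlim_compose[OF tendsto_power_div_exp_0 filterlim_inverse_at_top_right])
  then show "(flat k \<longlongrightarrow> 0) (at_right 0)"
    by (rule Lim_transform_eventually) (auto simp: flat_def eventually_at_filter exp_minus divide_inverse)
qed

text \<open>The only delicate point is 0, where the difference quotient of \<open>flat k\<close> is
  \<open>flat (k + 1)\<close> itself, which tends to 0.\<close>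

lemma DERIV_flat: "(flat k has_real_derivative flat (k + 2) t - real k * flat (k + 1) t) (at t)"
proof -
  consider "t < 0" | "t > 0" | "t = 0" by linarith
  then show ?thesis
  proof cases
    case 1
    have "(flat k has_real_derivative 0) (at t)"
      by (rule has_field_derivative_transform_within_open[of "\<lambda>_. 0" _ _ "{..<0}"])
        (use 1 in \<open>auto simp: flat_def\<close>)
    then show ?thesis using 1 by (simp add: flat_def)
  next
    case 2
    have e: "((\<lambda>s. exp (- inverse s)) has_real_derivative exp (- inverse t) * inverse t ^ 2) (at t)"
      using 2 by (auto intro!: derivative_eq_intros simp: power2_eq_square)
    have p: "((\<lambda>s. inverse s ^ k) has_real_derivative - (real k * inverse t ^ (k + 1))) (at t)"
    proof (cases k)
      case (Suc j)
      with DERIV_power_Suc[OF DERIV_inverse[of t], of j] 2 show ?thesis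
        by (simp add: mult_ac)
    qed simp
    have "((\<lambda>s. inverse s ^ k * exp (- inverse s)) has_real_derivative
        flat (k + 2) t - real k * flat (k + 1) t) (at t)"
      using DERIV_mult[OF p e] 2 by (simp add: flat_def algebra_simps power2_eq_square)
    then show ?thesis
      by (rule has_field_derivative_transform_within_open[of _ _ _ "{0<..}"])
        (use 2 in \<open>auto simp: flat_def\<close>)
  next
    case 3
    have "(\<lambda>h. flat k h / h) = flat (k + 1)"
      by (auto simp: fun_eq_iff flat_def divide_inverse)
    then have "(flat k has_real_derivative 0) (at 0)"
      using flat_tendsto_0[of "k + 1"] by (simp add: DERIV_def flat_def[of k 0])
    then show ?thesis using 3 by (simp add: flat_def)
  qed
qed

lemma flat_0_tendsto_1:
  assumes "c > 0"
  shows "(\<lambda>n. flat 0 (real (Suc n) * c)) \<longlonglongrightarrow> 1"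
proof -
  have "(\<lambda>n. exp (- (inverse (real (Suc n)) * inverse c))) \<longlonglongrightarrow> exp (- (0 * inverse c))"
    by (intro tendsto_intros LIMSEQ_inverse_real_of_nat)
  moreover have "flat 0 (real (Suc n) * c) = exp (- (inverse (real (Suc n)) * inverse c))" for n
    using assms by (simp add: flat_def del: of_nat_Suc)
  ultimately show ?thesis by simp
qed

section \<open>Stability of \<open>Ck_on\<close> under sums and products\<close>

lemma frechet_derivative_eq:
  "(f has_derivative f') (at x) \<Longrightarrow> frechet_derivative f (at x) = f'"
  using frechet_derivative_at by metis

lemma Ck_on_SucI:
  assumes "\<And>x. (f has_derivative f' x) (at x)" "\<And>v. Ck_on k (\<lambda>x. f' x v) UNIV"
  shows "Ck_on (Suc k) f UNIV"
proof -
  have "f differentiable at x" for x using assms(1) by (rule differentiableI)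
  moreover have "frechet_derivative f (at x) = f' x" for x
    by (rule frechet_derivative_eq[OF assms(1)])
  ultimately show ?thesis using assms(2) by simp
qed

lemma Ck_on_const: "Ck_on k (\<lambda>_. c) UNIV"
proof (induction k arbitrary: c)
  case (Suc k)
  show ?case by (rule Ck_on_SucI[of _ "\<lambda>_ _. 0"]) (auto intro: Suc.IH)
qed simp

lemma Ck_on_SucD: "Ck_on (Suc k) f U \<Longrightarrow> Ck_on k f U"
proof (induction k arbitrary: f)
  case 0
  then show ?case
    by (auto intro!: continuous_at_imp_continuous_on differentiable_imp_continuous_within)
next
  case (Suc k)
  then show ?case by (subst Ck_on.simps(2), subst (asm) (2) Ck_on.simps(2)) auto
qed

lemma Ck_on_Suc_has_derivative:
  "Ck_on (Suc k) f U \<Longrightarrow> x \<in> U \<Longrightarrow> (f has_derivative frechet_derivative f (at x)) (at x)"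
  by (simp add: frechet_derivative_works[symmetric])

lemma Ck_on_add:
  fixes f g :: "'a::euclidean_space \<Rightarrow> real"
  shows "Ck_on k f UNIV \<Longrightarrow> Ck_on k g UNIV \<Longrightarrow> Ck_on k (\<lambda>x. f x + g x) UNIV"
proof (induction k arbitrary: f g)
  case (Suc k)
  show ?case
    by (rule Ck_on_SucI[OF has_derivative_add[OF Ck_on_Suc_has_derivative[OF Suc.prems(1)]
            Ck_on_Suc_has_derivative[OF Suc.prems(2)]]]) (use Suc in auto)
qed (auto intro: continuous_on_add)

lemma Ck_on_mult:
  fixes f g :: "'a::euclidean_space \<Rightarrow> real"
  shows "Ck_on k f UNIV \<Longrightarrow> Ck_on k g UNIV \<Longrightarrow> Ck_on k (\<lambda>x. f x * g x) UNIV"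
proof (induction k arbitrary: f g)
  case (Suc k)
  show ?case
  proof (rule Ck_on_SucI[OF has_derivative_mult[OF Ck_on_Suc_has_derivative[OF Suc.prems(1)]
            Ck_on_Suc_has_derivative[OF Suc.prems(2)]]])
    show "Ck_on k (\<lambda>x. f x * frechet_derivative g (at x) v + frechet_derivative f (at x) v * g x) UNIV" for v
      using Suc.prems by (intro Ck_on_add Suc.IH Ck_on_SucD[OF Suc.prems(1)] Ck_on_SucD[OF Suc.prems(2)]) auto
  qed auto
qed (auto intro: continuous_on_mult)

lemma Ck_on_prod:
  fixes f :: "'i \<Rightarrow> 'a::euclidean_space \<Rightarrow> real"
  assumes "finite I" "\<And>i. i \<in> I \<Longrightarrow> Ck_on k (f i) UNIV"
  shows "Ck_on k (\<lambda>x. \<Prod>i\<in>I. f i x) UNIV"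
  using assms
proof (induction I rule: finite_induct)
  case empty
  show ?case using Ck_on_const[of k 1] by simp
next
  case (insert i I)
  then show ?case using Ck_on_mult[of k "f i" "\<lambda>x. \<Prod>i\<in>I. f i x"] by simp
qed

text \<open>The induction on the order must leave \<open>k\<close> free, because differentiation
  raises this index.\<close>

lemma Ck_on_flat: "Ck_on n (\<lambda>x::'a::euclidean_space. flat k (x \<bullet> b + a)) UNIV"
proof (induction n arbitrary: k)
  case 0
  have "continuous_on UNIV (flat k)"
    using DERIV_flat DERIV_isCont by (blast intro: continuous_at_imp_continuous_on)
  then show ?case
    by (auto intro!: continuous_on_compose2[of UNIV "flat k"] continuous_intros)
next
  case (Suc n)
  show ?case
  proof (rule Ck_on_SucI)
    show "((\<lambda>x. flat k (x \<bullet> b + a)) has_derivative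
      (\<lambda>v. (v \<bullet> b) * (flat (k + 2) (x \<bullet> b + a) + (- real k) * flat (k + 1) (x \<bullet> b + a)))) (at x)" for x :: 'a
    proof -
      have "((\<lambda>x. x \<bullet> b + a) has_derivative (\<lambda>v. v \<bullet> b)) (at x)"
        by (auto intro!: derivative_eq_intros)
      from has_derivative_compose[OF this DERIV_flat[unfolded has_field_derivative_def, of k "x \<bullet> b + a"]]
      show ?thesis by (simp add: mult.commute)
    qed
    show "Ck_on n (\<lambda>x::'a. (v \<bullet> b) * (flat (k + 2) (x \<bullet> b + a) + (- real k) * flat (k + 1) (x \<bullet> b + a))) UNIV" for v
      by (intro Ck_on_mult Ck_on_add Ck_on_const Suc.IH)
  qed
qed

text \<open>For \<open>n > 0\<close> this is smooth and positive exactly on the open box with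
  corners \<open>l\<close> and \<open>h\<close>. The parameter \<open>n\<close> steepens the
  factors, so that the bumps tend to the indicator of the box.\<close>

definition box_bump :: "'a::euclidean_space \<Rightarrow> 'a \<Rightarrow> real \<Rightarrow> 'a \<Rightarrow> real" where
  "box_bump l h n x =
     (\<Prod>b\<in>Basis. flat 0 (n * (x \<bullet> b - l \<bullet> b)) * flat 0 (n * (h \<bullet> b - x \<bullet> b)))"

lemma Ck_on_box_bump: "Ck_on k (box_bump l h n) UNIV"
proof -
  \<comment> \<open>Every factor becomes \<open>flat 0\<close> of an affine function of
    \<open>x\<close>, the shape treated by \<open>Ck_on_flat\<close>.\<close>
  have "box_bump l h n = (\<lambda>x. \<Prod>b\<in>Basis. flat 0 (x \<bullet> (n *\<^sub>R b) + - (n * (l \<bullet> b))) * flat 0 (x \<bullet> (- n *\<^sub>R b) + n * (h \<bullet> b)))"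
    by (auto simp: box_bump_def fun_eq_iff algebra_simps intro!: prod.cong)
  then show ?thesis
    by (simp only:) (intro Ck_on_prod Ck_on_mult Ck_on_flat finite_Basis)
qed

lemma box_bump_eq_0: "x \<notin> box l h \<Longrightarrow> n > 0 \<Longrightarrow> box_bump l h n x = 0"
  by (auto simp: box_bump_def mem_box flat_def zero_less_mult_iff)

lemma box_bump_01: "0 \<le> box_bump l h n x" "box_bump l h n x \<le> 1"
proof -
  have "0 \<le> flat 0 t" "flat 0 t \<le> 1" for t by (auto simp: flat_def)
  then show "0 \<le> box_bump l h n x" "box_bump l h n x \<le> 1"
    unfolding box_bump_def by (auto intro!: prod_nonneg prod_le_1 mult_le_one)
qed

lemma test_function_box_bump:
  assumes "cbox l h \<subseteq> \<Omega>" "n > 0"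
  shows "test_function \<Omega> (box_bump l h n)"
proof -
  have "closure {x. box_bump l h n x \<noteq> 0} \<subseteq> cbox l h"
    using box_bump_eq_0[of _ l h n] assms(2) box_subset_cbox by (intro closure_minimal) auto
  moreover from this have "compact (closure {x. box_bump l h n x \<noteq> 0})"
    using compact_Int_closed[OF compact_cbox[of l h] closed_closure] by (metis inf.absorb2)
  ultimately show ?thesis
    unfolding test_function_def using Ck_on_box_bump assms(1) by blast
qed

lemma box_bump_tendsto: "(\<lambda>n. box_bump l h (real (Suc n)) x) \<longlonglongrightarrow> indicator (box l h) x"
proof (cases "x \<in> box l h")
  case True
  then have "(\<lambda>n. box_bump l h (real (Suc n)) x) \<longlonglongrightarrow> (\<Prod>b\<in>(Basis::'a set). 1 * 1)"
    unfolding box_bump_def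
    by (intro tendsto_prod tendsto_mult flat_0_tendsto_1) (auto simp: mem_box)
  then show ?thesis using True by simp
next
  case False
  then have "(\<lambda>n. box_bump l h (real (Suc n)) x) = (\<lambda>n. 0)"
    by (intro ext box_bump_eq_0) auto
  then show ?thesis using False by simp
qed

text \<open>Bumps with values between 0 and 1 converge to the indicator of the open box. Local
  integrability on the compact closed box provides the majorant.\<close>

lemma integral_box_eq_0:
  fixes G :: "'a::euclidean_space \<Rightarrow> 'b::euclidean_space"
  assumes G: "L1_loc \<Omega> G" and \<phi>: "\<And>\<phi>. test_function \<Omega> \<phi> \<Longrightarrow> (LINT x:\<Omega>|lebesgue. \<phi> x *\<^sub>R G x) = 0"
    and lh: "cbox l h \<subseteq> \<Omega>"
  shows "(LINT x:box l h|lebesgue. G x) = 0"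
proof -
  let ?g = "\<lambda>x. indicator (cbox l h) x *\<^sub>R G x"
  let ?b = "\<lambda>n. box_bump l h (real (Suc n))"
  have i: "integrable lebesgue ?g"
    using G lh by (simp add: L1_loc_def set_integrable_def)
  have mb: "?b n \<in> borel_measurable lebesgue" for n
    using Ck_on_box_bump[of 0 l h "real (Suc n)"]
    by (intro measurable_completion) (auto intro: borel_measurable_continuous_onI)
  have "(\<lambda>n. LINT x|lebesgue. ?b n x *\<^sub>R ?g x) \<longlonglongrightarrow> (LINT x|lebesgue. indicator (box l h) x *\<^sub>R G x)"
  proof (rule integral_dominated_convergence[where w="\<lambda>x. norm (?g x)"])
    have "integrable lebesgue (\<lambda>x. indicator (box l h) x *\<^sub>R ?g x)"
      by (intro integrable_mult_indicator i) auto
    also have "(\<lambda>x. indicator (box l h) x *\<^sub>R ?g x) = (\<lambda>x. indicator (box l h) x *\<^sub>R G x)"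
      using box_subset_cbox by (auto simp: indicator_def fun_eq_iff)
    finally show "(\<lambda>x. indicator (box l h) x *\<^sub>R G x) \<in> borel_measurable lebesgue" by auto
    show "(\<lambda>x. ?b n x *\<^sub>R ?g x) \<in> borel_measurable lebesgue" for n
      by (intro borel_measurable_scaleR mb borel_measurable_integrable[OF i])
    show "integrable lebesgue (\<lambda>x. norm (?g x))" by (intro integrable_norm i)
    have "(\<lambda>n. ?b n x *\<^sub>R ?g x) \<longlonglongrightarrow> indicator (box l h) x *\<^sub>R ?g x" for x
      by (intro tendsto_intros box_bump_tendsto)
    moreover have "indicator (box l h) x *\<^sub>R ?g x = indicator (box l h) x *\<^sub>R G x" for x
      using box_subset_cbox[of l h] by (auto simp: indicator_def)
    ultimately have "(\<lambda>n. ?b n x *\<^sub>R ?g x) \<longlonglongrightarrow> indicator (box l h) x *\<^sub>R G x" for x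
      by (simp only:)
    then show "AE x in lebesgue. (\<lambda>n. ?b n x *\<^sub>R ?g x) \<longlonglongrightarrow> indicator (box l h) x *\<^sub>R G x"
      by (rule AE_I2)
    show "AE x in lebesgue. norm (?b n x *\<^sub>R ?g x) \<le> norm (?g x)" for n
      using box_bump_01[of l h "real (Suc n)"]
      by (intro AE_I2, unfold norm_scaleR, intro mult_left_le_one_le) auto
  qed
  moreover have "(LINT x|lebesgue. ?b n x *\<^sub>R ?g x) = 0" for n
  proof -
    have "(\<lambda>x. ?b n x *\<^sub>R ?g x) = (\<lambda>x. indicator \<Omega> x *\<^sub>R (?b n x *\<^sub>R G x))"
    proof
      show "?b n x *\<^sub>R ?g x = indicator \<Omega> x *\<^sub>R (?b n x *\<^sub>R G x)" for x
        using lh box_subset_cbox[of l h] box_bump_eq_0[of x l h "real (Suc n)"]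
        by (cases "x \<in> box l h") (auto simp: indicator_def)
    qed
    moreover have "(LINT x:\<Omega>|lebesgue. ?b n x *\<^sub>R G x) = 0"
      by (intro \<phi> test_function_box_bump lh) simp
    ultimately show ?thesis
      by (simp only: set_lebesgue_integral_def)
  qed
  ultimately have "(\<lambda>n::nat. 0) \<longlonglongrightarrow> (LINT x|lebesgue. indicator (box l h) x *\<^sub>R G x)"
    by (simp only:)
  then show ?thesis
    by (simp add: set_lebesgue_integral_def LIMSEQ_const_iff)
qed

text \<open>A countable cover of finite measure for \<open>lborel\<close> serves its completion too.
  The result is what allows \<open>density_zero\<close> to be applied over
  \<open>lebesgue\<close>.\<close>

lemma sigma_finite_lebesgue: "sigma_finite_measure (lebesgue :: 'a::euclidean_space measure)"
proof -
  obtain A :: "'a set set" where A: "countable A" "A \<subseteq> sets lborel" "\<Union>A = space lborel"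
    "\<forall>a\<in>A. emeasure lborel a \<noteq> \<infinity>"
    using lborel.sigma_finite_countable by blast
  show ?thesis
  proof
    have "A \<subseteq> sets lebesgue" "\<Union>A = space lebesgue"
      using A(2,3) by auto
    moreover have "\<forall>a\<in>A. emeasure lebesgue a \<noteq> \<infinity>"
      using A(2,4) by auto
    ultimately show "\<exists>A. countable A \<and> A \<subseteq> sets (lebesgue :: 'a measure) \<and> \<Union>A = space lebesgue \<and>
        (\<forall>a\<in>A. emeasure (lebesgue :: 'a measure) a \<noteq> \<infinity>)"
      using A(1) by blast
  qed
qed

text \<open>This is the fundamental lemma of the calculus of variations. Vanishing integrals pass
  from boxes to Borel sets and then to Lebesgue sets inside a fixed box, which forces
  \<open>G\<close> to vanish there almost everywhere; countably many boxes exhaust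
  \<open>\<Omega>\<close>.\<close>

lemma AE_eq_0_if_test_integrals_eq_0:
  fixes G :: "'a::euclidean_space \<Rightarrow> 'b::euclidean_space"
  assumes \<Omega>: "open \<Omega>"
    and G: "L1_loc \<Omega> G" and \<phi>: "\<And>\<phi>. test_function \<Omega> \<phi> \<Longrightarrow> (LINT x:\<Omega>|lebesgue. \<phi> x *\<^sub>R G x) = 0"
  shows "AE x in lebesgue. x \<in> \<Omega> \<longrightarrow> G x = 0"
proof -
  have cb: "AE x in lebesgue. x \<in> cbox l h \<longrightarrow> G x = 0" if lh: "cbox l h \<subseteq> \<Omega>" for l h
  proof -
    define g where "g x = indicator (box l h) x *\<^sub>R G x" for x
    have "integrable lebesgue (\<lambda>x. indicator (cbox l h) x *\<^sub>R G x)"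
      using G lh by (simp add: L1_loc_def set_integrable_def)
    then have "integrable lebesgue (\<lambda>x. indicator (box l h) x *\<^sub>R (indicator (cbox l h) x *\<^sub>R G x))"
      by (rule integrable_mult_indicator[rotated]) auto
    also have "(\<lambda>x. indicator (box l h) x *\<^sub>R (indicator (cbox l h) x *\<^sub>R G x)) = g"
      using box_subset_cbox by (auto simp: indicator_def fun_eq_iff g_def)
    finally have ig: "integrable lebesgue g" .
    have g0: "(LINT x|lebesgue. g x) = 0"
      using integral_box_eq_0[OF G \<phi> lh] by (simp add: g_def[abs_def] set_lebesgue_integral_def)
    have borel0: "(LINT x:A|lebesgue. g x) = 0" if "A \<in> sets borel" for A
    proof -
      let ?B = "range (\<lambda>(a, b). box a b) :: 'a set set"
      have borelI: "X \<in> sets lebesgue" if "X \<in> sigma_sets UNIV ?B" for X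
      proof -
        have "X \<in> sets borel" using that unfolding borel_eq_box by simp
        then show ?thesis by simp
      qed
      \<comment> \<open>Open boxes are an intersection-stable generator of the Borel sets, so
        Dynkin's induction over complements and disjoint unions applies.\<close>
      have "Int_stable ?B" "?B \<subseteq> Pow UNIV" "A \<in> sigma_sets UNIV ?B"
        using that unfolding borel_eq_box by (auto simp: Int_stable_def box_Int_box)
      then show ?thesis
      proof (induction rule: sigma_sets_induct_disjoint)
        case (basic A)
        then obtain a b where A: "A = box a b" by auto
        \<comment> \<open>These are the corners of the intersection of the two boxes. The matching
          formula for closed boxes keeps it within \<open>\<Omega>\<close>.\<close>
        define c d where "c = (\<Sum>i\<in>Basis. max (a \<bullet> i) (l \<bullet> i) *\<^sub>R i)" and "d = (\<Sum>i\<in>Basis. min (b \<bullet> i) (h \<bullet> i) *\<^sub>R i)"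
        have "box a b \<inter> box l h = box c d" "cbox a b \<inter> cbox l h = cbox c d"
          unfolding c_def d_def by (rule box_Int_box Int_interval)+
        then have "(LINT x:A|lebesgue. g x) = (LINT x:box c d|lebesgue. G x)" "cbox c d \<subseteq> \<Omega>"
          using lh unfolding A g_def set_lebesgue_integral_def by (auto simp: indicator_inter_arith[symmetric])
        then show ?case using integral_box_eq_0[OF G \<phi>, of c d] by simp
      next
        case (compl A)
        have A: "A \<in> sets lebesgue"
          by (rule borelI[OF compl(1)])
        have "(LINT x:UNIV - A|lebesgue. g x) = (LINT x|lebesgue. g x - indicator A x *\<^sub>R g x)"
          unfolding set_lebesgue_integral_def by (intro Bochner_Integration.integral_cong) (auto simp: indicator_def)
        also have "\<dots> = 0"
          using g0 compl(2) ig A by (simp add: set_lebesgue_integral_def integrable_mult_indicator)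
        finally show ?case .
      next
        case (union A)
        have A: "A i \<in> sets lebesgue" for i
          using union(2) by (intro borelI) auto
        have "(LINT x:(\<Union>i. A i)|lebesgue. g x) = (\<Sum>i. LINT x:A i|lebesgue. g x)"
          using union(1) A ig
          by (intro lebesgue_integral_countable_add)
            (auto simp: disjoint_family_on_def set_integrable_def intro: integrable_mult_indicator)
        then show ?case using union(3) by simp
      qed (simp add: set_lebesgue_integral_def)
    qed
    have "AE x in lebesgue. g x = 0"
    proof (rule sigma_finite_measure.density_zero[OF sigma_finite_lebesgue ig])
      fix A :: "'a set" assume A: "A \<in> sets lebesgue"
      \<comment> \<open>A Lebesgue set is a Borel set up to a null set, which does not affect the
        integral.\<close>
      then obtain S N N' where SN: "A = S \<union> N" "N \<subseteq> N'" "N' \<in> null_sets lborel" "S \<in> sets lborel"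
        by (rule sets_completionE)
      have S: "S \<in> sets lebesgue" using SN(4) by auto
      have "AE x in lebesgue. x \<notin> N'"
        using SN(3) by (intro AE_not_in null_sets_completionI)
      then have "AE x in lebesgue. indicator S x *\<^sub>R g x = indicator A x *\<^sub>R g x"
        by eventually_elim (use SN in \<open>auto simp: indicator_def\<close>)
      from integrable_lebesgue_AE_cong(2)[OF integrable_mult_indicator[OF S ig] this]
      show "(LINT x:A|lebesgue. g x) = 0"
        using borel0[of S] SN(4) by (simp add: set_lebesgue_integral_def)
    qed
    \<comment> \<open>On the faces of the box \<open>g\<close> is 0 whatever the value of
      \<open>G\<close>, but the faces form a null set.\<close>
    moreover have "AE x in lebesgue. x \<notin> cbox l h - box l h"
      using negligible_frontier_interval[of l h] by (intro AE_not_in) (simp add: negligible_iff_null_sets)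
    ultimately show ?thesis
      by eventually_elim (auto simp: g_def)
  qed
  obtain \<D> where \<D>: "countable \<D>" "\<D> \<subseteq> Pow \<Omega>" "\<And>X. X \<in> \<D> \<Longrightarrow> \<exists>a b. X = cbox a b" "\<Union>\<D> = \<Omega>"
    using open_countable_Union_open_cbox[OF \<Omega>] by metis
  have "AE x in lebesgue. \<forall>X\<in>\<D>. x \<in> X \<longrightarrow> G x = 0"
    using \<D>(1)
  proof (rule AE_ball_countable[THEN iffD2, rule_format])
    fix X assume "X \<in> \<D>"
    then obtain a b where "X = cbox a b" "cbox a b \<subseteq> \<Omega>" using \<D>(2,3) by blast
    then show "AE x in lebesgue. x \<in> X \<longrightarrow> G x = 0" using cb by blast
  qed
  then show ?thesis
    by eventually_elim (use \<D>(4) in auto)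
qed

section \<open>Weak gradients\<close>

lemma set_integral_AE_cong:
  fixes f g :: "'a::euclidean_space \<Rightarrow> 'b::euclidean_space"
  assumes "set_integrable lebesgue \<Omega> f" "AE x in lebesgue. x \<in> \<Omega> \<longrightarrow> f x = g x"
  shows "set_integrable lebesgue \<Omega> g" "(LINT x:\<Omega>|lebesgue. g x) = (LINT x:\<Omega>|lebesgue. f x)"
proof -
  have ae: "AE x in lebesgue. indicator \<Omega> x *\<^sub>R f x = indicator \<Omega> x *\<^sub>R g x"
    using assms(2) by eventually_elim (auto simp: indicator_def)
  show "set_integrable lebesgue \<Omega> g" "(LINT x:\<Omega>|lebesgue. g x) = (LINT x:\<Omega>|lebesgue. f x)"
    using integrable_lebesgue_AE_cong[OF assms(1)[unfolded set_integrable_def] ae]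
    unfolding set_integrable_def set_lebesgue_integral_def by auto
qed

section \<open>Classical gradients and test functions\<close>

lemma GDERIV_unique: "GDERIV f x :> D \<Longrightarrow> GDERIV f x :> E \<Longrightarrow> D = E"
proof -
  assume "GDERIV f x :> D" "GDERIV f x :> E"
  then have "(\<lambda>h. h \<bullet> D) = (\<lambda>h. h \<bullet> E)"
    unfolding gderiv_def by (rule has_derivative_unique)
  from fun_cong[OF this, of "D - E"] have "(D - E) \<bullet> (D - E) = 0"
    by (simp add: inner_diff_right)
  then show "D = E" by simp
qed

lemma grad_eq: "GDERIV f x :> D \<Longrightarrow> grad f x = D"
  unfolding grad_def by (rule the_equality) (auto intro: GDERIV_unique)

text \<open>By linearity the derivative is the inner product with the vector of its values on the
  basis, which determines the definite description in \<open>grad\<close>.\<close>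

lemma differentiable_grad:
  fixes f :: "'a::euclidean_space \<Rightarrow> real"
  assumes "f differentiable at x"
  shows "GDERIV f x :> grad f x" "grad f x = (\<Sum>b\<in>Basis. frechet_derivative f (at x) b *\<^sub>R b)"
proof -
  let ?f' = "frechet_derivative f (at x)"
  have f': "(f has_derivative ?f') (at x)" using assms frechet_derivative_works by blast
  then interpret bounded_linear ?f' by (rule has_derivative_bounded_linear)
  have "?f' h = h \<bullet> (\<Sum>b\<in>Basis. ?f' b *\<^sub>R b)" for h
  proof -
    have "?f' h = ?f' (\<Sum>b\<in>Basis. (h \<bullet> b) *\<^sub>R b)" by (simp add: euclidean_representation)
    also have "\<dots> = (\<Sum>b\<in>Basis. (h \<bullet> b) *\<^sub>R ?f' b)" by (simp add: sum scale)
    finally show ?thesis by (simp add: inner_sum_right mult.commute)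
  qed
  then have "?f' = (\<lambda>h. h \<bullet> (\<Sum>b\<in>Basis. ?f' b *\<^sub>R b))" by blast
  with f' have g: "GDERIV f x :> (\<Sum>b\<in>Basis. ?f' b *\<^sub>R b)"
    unfolding gderiv_def by (simp only:)
  from grad_eq[OF g] show "grad f x = (\<Sum>b\<in>Basis. ?f' b *\<^sub>R b)" .
  with g show "GDERIV f x :> grad f x" by simp
qed

lemma continuous_on_grad:
  fixes f :: "'a::euclidean_space \<Rightarrow> real"
  assumes "Ck_on 1 f U"
  shows "continuous_on U (grad f)"
proof -
  have "continuous_on U (\<lambda>x. \<Sum>b\<in>Basis. frechet_derivative f (at x) b *\<^sub>R b)"
    using assms by (intro continuous_intros) auto
  then show ?thesis
    by (rule continuous_on_eq) (use assms in \<open>simp add: differentiable_grad(2)\<close>)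
qed

lemma test_function_imp_C1:
  fixes \<phi> :: "'a::euclidean_space \<Rightarrow> real"
  assumes "test_function \<Omega> \<phi>"
  shows "GDERIV \<phi> x :> grad \<phi> x" "continuous_on UNIV (grad \<phi>)" "continuous_on UNIV \<phi>"
proof -
  have C1: "Ck_on 1 \<phi> UNIV" using assms unfolding test_function_def by blast
  then show "GDERIV \<phi> x :> grad \<phi> x" by (auto intro: differentiable_grad(1))
  show "continuous_on UNIV (grad \<phi>)" by (rule continuous_on_grad[OF C1])
  have "Ck_on 0 \<phi> UNIV" using assms unfolding test_function_def by blast
  then show "continuous_on UNIV \<phi>" by simp
qed

lemma test_function_support:
  fixes \<phi> :: "'a::euclidean_space \<Rightarrow> real"
  assumes "test_function \<Omega> \<phi>"
  defines "K \<equiv> closure {x. \<phi> x \<noteq> 0}"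
  shows "compact K" "K \<subseteq> \<Omega>" "x \<notin> K \<Longrightarrow> \<phi> x = 0" "x \<notin> K \<Longrightarrow> grad \<phi> x = 0"
proof -
  show K: "compact K" "K \<subseteq> \<Omega>" using assms by (auto simp: test_function_def)
  show z: "\<phi> x = 0" if "x \<notin> K" for x
    using that closure_subset[of "{x. \<phi> x \<noteq> 0}"] unfolding K_def by blast
  show "x \<notin> K \<Longrightarrow> grad \<phi> x = 0"
    by (rule gradient_eq_0_outside[OF test_function_imp_C1(1)[OF assms(1)] K(1) z])
qed

lemma L1_loc_continuous:
  fixes f :: "'a::euclidean_space \<Rightarrow> 'b::euclidean_space"
  assumes "continuous_on \<Omega> f"
  shows "L1_loc \<Omega> f"
  unfolding L1_loc_def
proof (intro allI impI)
  fix K assume "compact K \<and> K \<subseteq> \<Omega>"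
  then have "integrable lborel (\<lambda>x. indicator K x *\<^sub>R f x)"
    by (intro borel_integrable_compact continuous_on_subset[OF assms]) auto
  then show "f absolutely_integrable_on K"
    unfolding set_integrable_def by (rule integrable_lborel_imp_lebesgue)
qed

lemma set_integrable_test_scaleR:
  fixes G :: "'a::euclidean_space \<Rightarrow> 'b::euclidean_space"
  assumes "L1_loc \<Omega> G" "test_function \<Omega> \<phi>"
  shows "set_integrable lebesgue \<Omega> (\<lambda>x. \<phi> x *\<^sub>R G x)"
  using integrable_L1_loc_mult(2)[OF assms(1) test_function_support(1,2)[OF assms(2)]
      test_function_imp_C1(3)[OF assms(2)]] test_function_support(3)[OF assms(2)] by blast

text \<open>In \<open>integrable_L1_loc_mult\<close> the multiplier is a real function, so each
  component of \<open>grad \<phi>\<close> multiplies \<open>u\<close> separately and the vector is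
  reassembled.\<close>

lemma set_integrable_scaleR_grad_test:
  fixes u :: "'a::euclidean_space \<Rightarrow> real"
  assumes u: "L1_loc \<Omega> u" and \<phi>: "test_function \<Omega> \<phi>"
  shows "set_integrable lebesgue \<Omega> (\<lambda>x. u x *\<^sub>R grad \<phi> x)"
proof -
  have "set_integrable lebesgue \<Omega> (\<lambda>x. (grad \<phi> x \<bullet> b) *\<^sub>R u x)" for b
  proof -
    have "continuous_on UNIV (\<lambda>x. grad \<phi> x \<bullet> b)"
      by (intro continuous_intros test_function_imp_C1(2)[OF \<phi>])
    then show ?thesis
      by (rule integrable_L1_loc_mult(2)[OF u test_function_support(1,2)[OF \<phi>]])
        (simp add: test_function_support(4)[OF \<phi>])
  qed
  then have "integrable lebesgue (\<lambda>x. \<Sum>b\<in>Basis. (indicator \<Omega> x *\<^sub>R ((grad \<phi> x \<bullet> b) *\<^sub>R u x)) *\<^sub>R b)"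
    unfolding set_integrable_def
    by (intro Bochner_Integration.integrable_sum integrable_scaleR_left)
  also have "(\<lambda>x. \<Sum>b\<in>Basis. (indicator \<Omega> x *\<^sub>R ((grad \<phi> x \<bullet> b) *\<^sub>R u x)) *\<^sub>R b) =
      (\<lambda>x. indicator \<Omega> x *\<^sub>R (u x *\<^sub>R grad \<phi> x))"
  proof
    fix x
    have "(\<Sum>b\<in>Basis. (indicator \<Omega> x *\<^sub>R ((grad \<phi> x \<bullet> b) *\<^sub>R u x)) *\<^sub>R b) =
        (indicator \<Omega> x * u x) *\<^sub>R (\<Sum>b\<in>Basis. (grad \<phi> x \<bullet> b) *\<^sub>R b)"
      by (simp add: scaleR_sum_right mult_ac)
    then show "(\<Sum>b\<in>Basis. (indicator \<Omega> x *\<^sub>R ((grad \<phi> x \<bullet> b) *\<^sub>R u x)) *\<^sub>R b) =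
        indicator \<Omega> x *\<^sub>R (u x *\<^sub>R grad \<phi> x)"
      by (simp add: euclidean_representation)
  qed
  finally show ?thesis by (simp add: set_integrable_def)
qed

text \<open>The compact support of the test function makes integration by parts free of boundary
  terms; the vector identity is tested against each basis vector.\<close>

lemma has_weak_grad_classical:
  fixes u :: "'a::euclidean_space \<Rightarrow> real"
  assumes \<Omega>: "open \<Omega>" and u: "\<And>x. x \<in> \<Omega> \<Longrightarrow> GDERIV u x :> G x" "continuous_on \<Omega> G"
  shows "has_weak_grad \<Omega> u G"
proof -
  have "continuous_on \<Omega> u"
    using u(1) \<Omega> by (auto simp: gderiv_def continuous_on_eq_continuous_at intro: has_derivative_continuous)
  then have Lu: "L1_loc \<Omega> u" by (rule L1_loc_continuous)
  have LG: "L1_loc \<Omega> G" by (rule L1_loc_continuous[OF u(2)])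
  show ?thesis
    unfolding has_weak_grad_def
  proof (intro conjI allI impI Lu LG)
    fix \<phi> :: "'a \<Rightarrow> real" assume \<phi>: "test_function \<Omega> \<phi>"
    let ?a = "\<lambda>x. indicator \<Omega> x *\<^sub>R (u x *\<^sub>R grad \<phi> x)" and ?b = "\<lambda>x. indicator \<Omega> x *\<^sub>R (\<phi> x *\<^sub>R G x)"
    have z: "\<phi> x = 0" "grad \<phi> x = 0" if "x \<notin> \<Omega>" for x
    proof -
      have "x \<notin> closure {x. \<phi> x \<noteq> 0}" using test_function_support(2)[OF \<phi>] that by blast
      then show "\<phi> x = 0" "grad \<phi> x = 0"
        using test_function_support(3,4)[OF \<phi>] by blast+
    qed
    show "(LINT x:\<Omega>|lebesgue. u x *\<^sub>R grad \<phi> x) = - (LINT x:\<Omega>|lebesgue. \<phi> x *\<^sub>R G x)"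
    proof (rule euclidean_eqI)
      fix c :: 'a
      have ibp: "integrable lborel (\<lambda>x. u x * (grad \<phi> x \<bullet> c))" "integrable lborel (\<lambda>x. \<phi> x * (G x \<bullet> c))"
        "(LINT x|lborel. u x * (grad \<phi> x \<bullet> c)) = - (LINT x|lborel. \<phi> x * (G x \<bullet> c))"
        by (rule integration_by_parts_compact_support[OF \<Omega> test_function_support(1,2)[OF \<phi>]
              test_function_imp_C1(1,2)[OF \<phi>] _ u]; (rule test_function_support(3)[OF \<phi>])?; assumption)+
      have "integrable lebesgue ?a" "integrable lebesgue ?b"
        using set_integrable_scaleR_grad_test[OF Lu \<phi>] set_integrable_test_scaleR[OF LG \<phi>]
        by (auto simp: set_integrable_def)
      then have "(LINT x|lebesgue. ?a x) \<bullet> c = (LINT x|lebesgue. ?a x \<bullet> c)"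
        "(LINT x|lebesgue. ?b x) \<bullet> c = (LINT x|lebesgue. ?b x \<bullet> c)"
        by (simp_all only: integral_inner_left)
      moreover have "?a x \<bullet> c = u x * (grad \<phi> x \<bullet> c)" "?b x \<bullet> c = \<phi> x * (G x \<bullet> c)" for x
        using z[of x] by (cases "x \<in> \<Omega>"; simp)+
      ultimately show "(LINT x:\<Omega>|lebesgue. u x *\<^sub>R grad \<phi> x) \<bullet> c = (- (LINT x:\<Omega>|lebesgue. \<phi> x *\<^sub>R G x)) \<bullet> c"
        using ibp integrable_lborel_imp_lebesgue[OF ibp(1)] integrable_lborel_imp_lebesgue[OF ibp(2)]
        by (simp only: set_lebesgue_integral_def inner_minus_left)
    qed
  qed
qed

section \<open>Uniqueness and linearity of weak gradients\<close>

lemma L1_loc_diff: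
  fixes f g :: "'a::euclidean_space \<Rightarrow> 'b::euclidean_space"
  shows "L1_loc \<Omega> f \<Longrightarrow> L1_loc \<Omega> g \<Longrightarrow> L1_loc \<Omega> (\<lambda>x. f x - g x)"
  by (simp add: L1_loc_def set_integral_diff)

lemma L1_loc_add:
  fixes f g :: "'a::euclidean_space \<Rightarrow> 'b::euclidean_space"
  shows "L1_loc \<Omega> f \<Longrightarrow> L1_loc \<Omega> g \<Longrightarrow> L1_loc \<Omega> (\<lambda>x. f x + g x)"
  by (simp add: L1_loc_def set_integral_add)

text \<open>The difference of the two candidates integrates to 0 against every test function, so the
  fundamental lemma applies.\<close>

lemma has_weak_grad_unique:
  assumes "open \<Omega>" and 1: "has_weak_grad \<Omega> u G\<^sub>1" and 2: "has_weak_grad \<Omega> u G\<^sub>2"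
  shows "AE x in lebesgue. x \<in> \<Omega> \<longrightarrow> G\<^sub>1 x = G\<^sub>2 x"
proof -
  have L: "L1_loc \<Omega> G\<^sub>1" "L1_loc \<Omega> G\<^sub>2" using 1 2 by (auto simp: has_weak_grad_def)
  have "AE x in lebesgue. x \<in> \<Omega> \<longrightarrow> G\<^sub>1 x - G\<^sub>2 x = 0"
  proof (rule AE_eq_0_if_test_integrals_eq_0[OF assms(1) L1_loc_diff[OF L]])
    fix \<phi> assume \<phi>: "test_function \<Omega> \<phi>"
    have "(LINT x:\<Omega>|lebesgue. u x *\<^sub>R grad \<phi> x) = - (LINT x:\<Omega>|lebesgue. \<phi> x *\<^sub>R G\<^sub>1 x)"
      "(LINT x:\<Omega>|lebesgue. u x *\<^sub>R grad \<phi> x) = - (LINT x:\<Omega>|lebesgue. \<phi> x *\<^sub>R G\<^sub>2 x)"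
      using 1 2 \<phi> unfolding has_weak_grad_def by blast+
    then show "(LINT x:\<Omega>|lebesgue. \<phi> x *\<^sub>R (G\<^sub>1 x - G\<^sub>2 x)) = 0"
      using set_integral_diff(2)[OF set_integrable_test_scaleR[OF L(1) \<phi>] set_integrable_test_scaleR[OF L(2) \<phi>]]
      unfolding scaleR_diff_right by simp
  qed
  then show ?thesis by eventually_elim auto
qed

lemma has_weak_grad_weak_grad: "weakly_differentiable \<Omega> u \<Longrightarrow> has_weak_grad \<Omega> u (weak_grad \<Omega> u)"
  using someI_ex[of "has_weak_grad \<Omega> u"] by (simp add: weakly_differentiable_def weak_grad_def)

text \<open>The choice made by \<open>SOME\<close> in \<open>weak_grad\<close> becomes harmless: any
  known weak gradient may replace it under an integral.\<close>

lemma weak_grad_AE_eq: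
  assumes "open \<Omega>" "has_weak_grad \<Omega> u G"
  shows "AE x in lebesgue. x \<in> \<Omega> \<longrightarrow> weak_grad \<Omega> u x = G x"
proof (rule has_weak_grad_unique[OF assms(1) has_weak_grad_weak_grad assms(2)])
  show "weakly_differentiable \<Omega> u" using assms(2) unfolding weakly_differentiable_def by blast
qed

lemma has_weak_grad_add:
  assumes u: "has_weak_grad \<Omega> u G" and v: "has_weak_grad \<Omega> v E"
  shows "has_weak_grad \<Omega> (\<lambda>x. u x + v x) (\<lambda>x. G x + E x)"
  unfolding has_weak_grad_def
proof (intro conjI allI impI)
  have L: "L1_loc \<Omega> u" "L1_loc \<Omega> v" "L1_loc \<Omega> G" "L1_loc \<Omega> E"
    using u v by (auto simp: has_weak_grad_def)
  show "L1_loc \<Omega> (\<lambda>x. u x + v x)" "L1_loc \<Omega> (\<lambda>x. G x + E x)"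
    by (intro L1_loc_add L)+
  fix \<phi> :: "'a \<Rightarrow> real" assume \<phi>: "test_function \<Omega> \<phi>"
  note uv = set_integral_add(2)[OF set_integrable_scaleR_grad_test[OF L(1) \<phi>] set_integrable_scaleR_grad_test[OF L(2) \<phi>]]
  note GE = set_integral_add(2)[OF set_integrable_test_scaleR[OF L(3) \<phi>] set_integrable_test_scaleR[OF L(4) \<phi>]]
  have "(LINT x:\<Omega>|lebesgue. u x *\<^sub>R grad \<phi> x) = - (LINT x:\<Omega>|lebesgue. \<phi> x *\<^sub>R G x)"
    "(LINT x:\<Omega>|lebesgue. v x *\<^sub>R grad \<phi> x) = - (LINT x:\<Omega>|lebesgue. \<phi> x *\<^sub>R E x)"
    using u v \<phi> unfolding has_weak_grad_def by blast+
  with uv GE show "(LINT x:\<Omega>|lebesgue. (u x + v x) *\<^sub>R grad \<phi> x) = - (LINT x:\<Omega>|lebesgue. \<phi> x *\<^sub>R (G x + E x))"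
    by (simp add: scaleR_add_left scaleR_add_right)
qed

lemma has_weak_grad_diff:
  assumes u: "has_weak_grad \<Omega> u G" and v: "has_weak_grad \<Omega> v E"
  shows "has_weak_grad \<Omega> (\<lambda>x. u x - v x) (\<lambda>x. G x - E x)"
  unfolding has_weak_grad_def
proof (intro conjI allI impI)
  have L: "L1_loc \<Omega> u" "L1_loc \<Omega> v" "L1_loc \<Omega> G" "L1_loc \<Omega> E"
    using u v by (auto simp: has_weak_grad_def)
  show "L1_loc \<Omega> (\<lambda>x. u x - v x)" "L1_loc \<Omega> (\<lambda>x. G x - E x)"
    by (intro L1_loc_diff L)+
  fix \<phi> :: "'a \<Rightarrow> real" assume \<phi>: "test_function \<Omega> \<phi>"
  note uv = set_integral_diff(2)[OF set_integrable_scaleR_grad_test[OF L(1) \<phi>] set_integrable_scaleR_grad_test[OF L(2) \<phi>]]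
  note GE = set_integral_diff(2)[OF set_integrable_test_scaleR[OF L(3) \<phi>] set_integrable_test_scaleR[OF L(4) \<phi>]]
  have "(LINT x:\<Omega>|lebesgue. u x *\<^sub>R grad \<phi> x) = - (LINT x:\<Omega>|lebesgue. \<phi> x *\<^sub>R G x)"
    "(LINT x:\<Omega>|lebesgue. v x *\<^sub>R grad \<phi> x) = - (LINT x:\<Omega>|lebesgue. \<phi> x *\<^sub>R E x)"
    using u v \<phi> unfolding has_weak_grad_def by blast+
  with uv GE show "(LINT x:\<Omega>|lebesgue. (u x - v x) *\<^sub>R grad \<phi> x) = - (LINT x:\<Omega>|lebesgue. \<phi> x *\<^sub>R (G x - E x))"
    by (simp add: scaleR_diff_left scaleR_diff_right)
qed

text \<open>This is the duality bound behind the passage to the limit in W_0^{1,1}. It serves the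
  direction field with bound 1 and, the inner product of reals being multiplication, also the
  bounded function \<open>H\<close>.\<close>

lemma set_integrable_bounded_inner:
  fixes N g :: "'a::euclidean_space \<Rightarrow> 'b::euclidean_space"
  assumes N: "(\<lambda>x. indicator \<Omega> x *\<^sub>R N x) \<in> borel_measurable lebesgue"
    "AE x in lebesgue. x \<in> \<Omega> \<longrightarrow> norm (N x) \<le> M"
    and g: "set_integrable lebesgue \<Omega> g"
  shows "set_integrable lebesgue \<Omega> (\<lambda>x. N x \<bullet> g x)"
    "\<bar>LINT x:\<Omega>|lebesgue. N x \<bullet> g x\<bar> \<le> M * (LINT x:\<Omega>|lebesgue. norm (g x))"
proof -
  let ?g = "\<lambda>x. indicator \<Omega> x *\<^sub>R g x"
  let ?f = "\<lambda>x. indicator \<Omega> x *\<^sub>R (N x \<bullet> g x)"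
  have ig: "integrable lebesgue ?g" using g by (simp add: set_integrable_def)
  have iM: "integrable lebesgue (\<lambda>x. M * norm (?g x))"
    by (intro integrable_mult_right integrable_norm ig)
  have f: "?f = (\<lambda>x. (indicator \<Omega> x *\<^sub>R N x) \<bullet> ?g x)"
    by (auto simp: indicator_def)
  have m: "?f \<in> borel_measurable lebesgue"
    unfolding f by (intro borel_measurable_inner N borel_measurable_integrable[OF ig])
  have b: "AE x in lebesgue. norm (?f x) \<le> M * norm (?g x)"
    using N(2)
  proof eventually_elim
    case (elim x)
    show ?case
    proof (cases "x \<in> \<Omega>")
      case True
      have "\<bar>N x \<bullet> g x\<bar> \<le> norm (N x) * norm (g x)" by (rule Cauchy_Schwarz_ineq2)
      also have "\<dots> \<le> M * norm (g x)" using elim True by (intro mult_right_mono) auto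
      finally show ?thesis using True by simp
    qed simp
  qed
  have i: "integrable lebesgue ?f"
    by (rule Bochner_Integration.integrable_bound[OF iM m])
      (use b in eventually_elim, use order_trans[OF _ abs_ge_self] in auto)
  then show "set_integrable lebesgue \<Omega> (\<lambda>x. N x \<bullet> g x)" by (simp add: set_integrable_def)
  have "\<bar>LINT x|lebesgue. ?f x\<bar> \<le> (LINT x|lebesgue. norm (?f x))"
    using integral_norm_bound[of lebesgue ?f] by simp
  also have "\<dots> \<le> (LINT x|lebesgue. M * norm (?g x))"
    by (rule integral_mono_AE[OF integrable_norm[OF i] iM b])
  also have "\<dots> = M * (LINT x|lebesgue. indicator \<Omega> x *\<^sub>R norm (g x))"
    by simp
  finally show "\<bar>LINT x:\<Omega>|lebesgue. N x \<bullet> g x\<bar> \<le> M * (LINT x:\<Omega>|lebesgue. norm (g x))"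
    by (simp only: set_lebesgue_integral_def)
qed

text \<open>Product rule for the inverse norm of \<open>p\<close> and \<open>p\<close>. The explicit
  formula lets continuity of the derivative be read off term by term where \<open>p\<close> is
  nonzero.\<close>

lemma has_derivative_normalized:
  fixes p :: "'a::real_normed_vector \<Rightarrow> 'b::real_inner"
  assumes "(p has_derivative p') (at x)" "p x \<noteq> 0"
  shows "((\<lambda>x. p x /\<^sub>R norm (p x)) has_derivative
    (\<lambda>h. inverse (norm (p x)) *\<^sub>R p' h + (- (inverse (norm (p x)) * (p' h \<bullet> sgn (p x)) * inverse (norm (p x)))) *\<^sub>R p x)) (at x)"
proof -
  have "((\<lambda>x. norm (p x)) has_derivative (\<lambda>h. p' h \<bullet> sgn (p x))) (at x)"
    by (rule has_derivative_compose[OF assms(1) has_derivative_norm[OF assms(2)]])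
  from has_derivative_scaleR[OF Deriv.has_derivative_inverse[OF _ this] assms(1)]
  show ?thesis using assms(2) by simp
qed

section \<open>The equation and the functional\<close>

text \<open>Continuity of \<open>F\<close> is available only at the nonsingular points. Each of them
  therefore gets its own ball on which the continuous sum stays nonzero.\<close>

lemma open_nonsingular:
  assumes "open \<Omega>" "continuous_on \<Omega> (grad u)" "\<And>x. x \<in> \<Omega> - singular_set \<Omega> F (grad u) \<Longrightarrow> F differentiable at x"
  shows "open (\<Omega> - singular_set \<Omega> F (grad u))"
  unfolding open_contains_ball
proof
  fix x assume x: "x \<in> \<Omega> - singular_set \<Omega> F (grad u)"
  then have "continuous (at x) (grad u)"
    using assms(1,2) continuous_on_eq_continuous_at by blast
  moreover have "continuous (at x) F"
    using assms(3)[OF x] by (rule differentiable_imp_continuous_within)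
  ultimately have "continuous (at x) (\<lambda>x. grad u x + F x)"
    by (rule continuous_add)
  moreover have "grad u x + F x \<noteq> 0" using x by (auto simp: singular_set_def)
  ultimately obtain e where e: "e > 0" "\<And>y. dist x y < e \<Longrightarrow> grad u y + F y \<noteq> 0"
    using continuous_at_avoid by blast
  obtain d where d: "d > 0" "ball x d \<subseteq> \<Omega>"
    using x assms(1) open_contains_ball by blast
  have "ball x (min d e) \<subseteq> \<Omega> - singular_set \<Omega> F (grad u)"
    using d(2) e(2) by (auto simp: singular_set_def subset_iff)
  then show "\<exists>e>0. ball x e \<subseteq> \<Omega> - singular_set \<Omega> F (grad u)"
    using d(1) e(1) by (intro exI[of _ "min d e"]) auto
qed

text \<open>The derivative of \<open>grad u\<close> is assembled from the second directional
  derivatives given by \<open>Ck_on 2\<close>; normalizing \<open>grad u + F\<close> then yields an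
  explicit derivative that is visibly continuous.\<close>

lemma direction_C1:
  fixes F :: "'a::euclidean_space \<Rightarrow> 'a"
  assumes U: "open U" and u: "Ck_on 2 u U" and F: "Ck_on 1 F U"
    and nz: "\<And>x. x \<in> U \<Longrightarrow> grad u x + F x \<noteq> 0"
  shows "\<And>x. x \<in> U \<Longrightarrow> direction F (grad u) differentiable at x"
    "\<And>v. continuous_on U (\<lambda>x. frechet_derivative (direction F (grad u)) (at x) v)"
proof -
  let ?p = "\<lambda>x. grad u x + F x"
  let ?u2 = "\<lambda>b x. frechet_derivative (\<lambda>x. frechet_derivative u (at x) b) (at x)"
  define p' where "p' x v = (\<Sum>b\<in>Basis. ?u2 b x v *\<^sub>R b) + frechet_derivative F (at x) v" for x v
  have u': "u differentiable at x" "(\<lambda>x. frechet_derivative u (at x) b) differentiable at x"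
    "continuous_on U (\<lambda>x. ?u2 b x v)" if "x \<in> U" for x b v
    using u that by (simp_all add: numeral_2_eq_2)
  have F': "F differentiable at x" "continuous_on U (\<lambda>x. frechet_derivative F (at x) v)" if "x \<in> U" for x v
    using F that by simp_all
  have dp: "(?p has_derivative p' x) (at x)" if x: "x \<in> U" for x
  proof -
    have "((\<lambda>x. frechet_derivative u (at x) b) has_derivative ?u2 b x) (at x)" for b
      using u'(2)[OF x] frechet_derivative_works by blast
    then have "((\<lambda>x. \<Sum>b\<in>Basis. frechet_derivative u (at x) b *\<^sub>R b) has_derivative
        (\<lambda>v. \<Sum>b\<in>Basis. ?u2 b x v *\<^sub>R b)) (at x)"
      by (intro has_derivative_sum has_derivative_scaleR_left)
    then have "(grad u has_derivative (\<lambda>v. \<Sum>b\<in>Basis. ?u2 b x v *\<^sub>R b)) (at x)"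
      by (rule has_derivative_transform_within_open[OF _ U x]) (simp add: differentiable_grad(2) u'(1))
    moreover have "(F has_derivative frechet_derivative F (at x)) (at x)"
      using F'(1)[OF x] frechet_derivative_works by blast
    ultimately show ?thesis
      unfolding p'_def by (rule has_derivative_add)
  qed
  define N' where "N' x h = inverse (norm (?p x)) *\<^sub>R p' x h +
    (- (inverse (norm (?p x)) * (p' x h \<bullet> sgn (?p x)) * inverse (norm (?p x)))) *\<^sub>R ?p x" for x h
  have dN: "(direction F (grad u) has_derivative N' x) (at x)" if x: "x \<in> U" for x
    unfolding N'_def direction_def[abs_def] by (rule has_derivative_normalized[OF dp[OF x] nz[OF x]])
  then show "direction F (grad u) differentiable at x" if "x \<in> U" for x
    using that by (blast intro: differentiableI)
  have cp: "continuous_on U ?p"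
    using dp by (auto intro!: continuous_at_imp_continuous_on intro: has_derivative_continuous)
  have cp': "continuous_on U (\<lambda>x. p' x v)" for v
  \<comment> \<open>The continuity facts for the second derivatives and for \<open>F\<close> are
    recorded at a point of \<open>U\<close>; for empty \<open>U\<close> the claim is
    trivial.\<close>
  proof (cases "U = {}")
    case False
    then obtain x where "x \<in> U" by blast
    then show ?thesis unfolding p'_def by (intro continuous_intros u'(3) F'(2))
  qed simp
  have "continuous_on U (\<lambda>x. N' x v)" for v
    unfolding N'_def using nz by (intro continuous_intros cp cp') auto
  then show "continuous_on U (\<lambda>x. frechet_derivative (direction F (grad u)) (at x) v)" for v
    by (rule continuous_on_eq) (simp add: frechet_derivative_eq[OF dN])
qed

lemma L_infinity_mult:
  fixes H :: "'a::euclidean_space \<Rightarrow> real"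
  assumes \<Omega>: "\<Omega> \<in> sets lebesgue" and H: "L_infinity \<Omega> H"
  obtains M where "M \<ge> 0" "\<And>w. set_integrable lebesgue \<Omega> w \<Longrightarrow> set_integrable lebesgue \<Omega> (\<lambda>x. H x * w x)"
    "\<And>w. set_integrable lebesgue \<Omega> w \<Longrightarrow>
      \<bar>LINT x:\<Omega>|lebesgue. H x * w x\<bar> \<le> M * (LINT x:\<Omega>|lebesgue. \<bar>w x\<bar>)"
proof -
  obtain M where M: "AE x in lebesgue_on \<Omega>. \<bar>H x\<bar> \<le> M" and m: "H \<in> borel_measurable (lebesgue_on \<Omega>)"
    using H by (auto simp: L_infinity_def)
  have "AE x in lebesgue. x \<in> \<Omega> \<longrightarrow> \<bar>H x\<bar> \<le> M"
    using M \<Omega> by (subst (asm) AE_restrict_space_iff) auto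
  \<comment> \<open>The maximum with 0 guarantees a nonnegative constant, as an essential bound over
    a null set could be negative.\<close>
  then have M': "AE x in lebesgue. x \<in> \<Omega> \<longrightarrow> norm (H x) \<le> max 0 M"
    by eventually_elim auto
  have m': "(\<lambda>x. indicator \<Omega> x *\<^sub>R H x) \<in> borel_measurable lebesgue"
    using m \<Omega> by (subst (asm) borel_measurable_restrict_space_iff) auto
  show thesis
    using that[of "max 0 M"] set_integrable_bounded_inner[OF m' M'] by simp
qed

text \<open>\<open>W11_norm\<close> contains the representative chosen for the difference. Almost
  everywhere it is the difference of \<open>grad \<psi>\<close> and the representative chosen for
  \<open>\<phi>\<close>, so the norm can be computed from these.\<close>

lemma W11_test_function_diff:
  assumes "open \<Omega>" "W11 \<Omega> \<phi>" "test_function \<Omega> \<psi>"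
  shows "set_integrable lebesgue \<Omega> \<psi>" "set_integrable lebesgue \<Omega> (grad \<psi>)"
    "W11_norm \<Omega> (\<lambda>x. \<psi> x - \<phi> x) =
      (LINT x:\<Omega>|lebesgue. \<bar>\<psi> x - \<phi> x\<bar>) + (LINT x:\<Omega>|lebesgue. norm (grad \<psi> x - weak_grad \<Omega> \<phi> x))"
proof -
  have mem: "\<Omega> \<in> sets lebesgue" using assms(1) by (intro sets_completionI_sets) auto
  note \<psi> = test_function_imp_C1[OF assms(3)] test_function_support[OF assms(3)]
  show i\<psi>: "set_integrable lebesgue \<Omega> \<psi>"
    unfolding set_integrable_def
    by (intro integrable_mult_indicator mem integrable_lborel_imp_lebesgue
        integrable_compact_support[OF \<psi>(3) \<psi>(4)] \<psi>(6))
  show ig: "set_integrable lebesgue \<Omega> (grad \<psi>)"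
    unfolding set_integrable_def
    by (intro integrable_mult_indicator mem integrable_lborel_imp_lebesgue
        integrable_compact_support[OF \<psi>(2) \<psi>(4)] \<psi>(7))
  have w: "has_weak_grad \<Omega> \<phi> (weak_grad \<Omega> \<phi>)" "set_integrable lebesgue \<Omega> (weak_grad \<Omega> \<phi>)"
    using assms(2) by (auto simp: W11_def intro: has_weak_grad_weak_grad)
  have "has_weak_grad \<Omega> \<psi> (grad \<psi>)"
    by (intro has_weak_grad_classical assms(1) \<psi>(1) continuous_on_subset[OF \<psi>(2)]) auto
  from weak_grad_AE_eq[OF assms(1) has_weak_grad_diff[OF this w(1)]]
  have ae: "AE x in lebesgue. x \<in> \<Omega> \<longrightarrow> norm (grad \<psi> x - weak_grad \<Omega> \<phi> x) = norm (weak_grad \<Omega> (\<lambda>x. \<psi> x - \<phi> x) x)"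
    by eventually_elim auto
  have "set_integrable lebesgue \<Omega> (\<lambda>x. norm (grad \<psi> x - weak_grad \<Omega> \<phi> x))"
    by (intro set_integrable_norm set_integral_diff ig w(2))
  from set_integral_AE_cong(2)[OF this ae]
  show "W11_norm \<Omega> (\<lambda>x. \<psi> x - \<phi> x) =
      (LINT x:\<Omega>|lebesgue. \<bar>\<psi> x - \<phi> x\<bar>) + (LINT x:\<Omega>|lebesgue. norm (grad \<psi> x - weak_grad \<Omega> \<phi> x))"
    by (simp add: W11_norm_def)
qed

theorem lemma6p1:
  fixes \<Omega> S :: "(real ^ 'm) set"
    and F :: "real ^ 'm \<Rightarrow> real ^ 'm"
    and H u :: "real ^ 'm \<Rightarrow> real"
  defines "S \<equiv> singular_set \<Omega> F (grad u)"
  assumes "open \<Omega>" "connected \<Omega>" "\<Omega> \<noteq> {}" "bounded \<Omega>"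
    and "L1_loc \<Omega> F"
    and "Ck_on 1 u \<Omega>" "Ck_on 2 u (\<Omega> - S)" "continuous_on (closure \<Omega>) u"
    and "Ck_on 1 F (\<Omega> - S)"
    and "continuous_on (\<Omega> - S) H" "L1_loc \<Omega> H"
    and "\<And>x. x \<in> \<Omega> - S \<Longrightarrow> divergence (direction F (grad u)) x = H x"
    and "hausdorff_measure (CARD('m) - 1) S = 0"
  shows "weak_solution \<Omega> F H u \<and>
    (W11 \<Omega> u \<and> L_infinity \<Omega> H \<and> F absolutely_integrable_on \<Omega> \<longrightarrow> is_minimizer \<Omega> F H u)"
proof -
  let ?N = "direction F (grad u)" and ?w = "weak_grad \<Omega> u"
  have dim: "DIM(real ^ 'm) = Suc (CARD('m) - 1)" by simp
  have mem: "\<Omega> \<in> sets lebesgue" using assms(2) by (intro sets_completionI_sets) auto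
  have cg: "continuous_on \<Omega> (grad u)" by (rule continuous_on_grad[OF assms(7)])
  have oU: "open (\<Omega> - S)"
    unfolding S_def using assms(10) by (intro open_nonsingular assms(2) cg) (simp add: S_def)
  have S\<Omega>: "S \<subseteq> \<Omega>" by (auto simp: S_def singular_set_def)
  have nz: "grad u x + F x \<noteq> 0" if "x \<in> \<Omega> - S" for x
    using that by (auto simp: S_def singular_set_def)
  note N = direction_C1[OF oU assms(8) assms(10) nz]
  \<comment> \<open>Where \<open>grad u x + F x\<close> is 0, the convention
    \<open>inverse 0 = 0\<close> makes the direction 0, so the bound holds at every point.\<close>
  have N1: "norm (?N x) \<le> 1" for x
    by (cases "grad u x + F x = 0") (simp_all add: direction_def)
  have main: "set_integrable lebesgue \<Omega> (\<lambda>x. ?N x \<bullet> grad \<phi> x)"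
    "(LINT x:\<Omega>|lebesgue. ?N x \<bullet> grad \<phi> x) + (LINT x:\<Omega>|lebesgue. H x * \<phi> x) = 0"
    if \<phi>: "test_function \<Omega> \<phi>" for \<phi>
    by (rule divergence_theorem_removable[OF dim assms(2) S\<Omega> oU assms(14) N N1 assms(13,12)
          test_function_imp_C1(1,2)[OF \<phi>] _ test_function_support(1,2)[OF \<phi>]];
        (rule test_function_support(3)[OF \<phi>])?; assumption)+
  have nS: "AE x in lebesgue. x \<notin> S"
    using hausdorff_null_imp_negligible[OF assms(2) S\<Omega> oU assms(14) dim]
    by (simp add: negligible_iff_null_sets AE_not_in)
  have wg: "has_weak_grad \<Omega> u (grad u)"
    using assms(7) by (intro has_weak_grad_classical assms(2) cg differentiable_grad(1)) simp
  have wd: "weakly_differentiable \<Omega> u"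
    using wg unfolding weakly_differentiable_def by blast
  have wae: "AE x in lebesgue. x \<in> \<Omega> \<longrightarrow> ?w x = grad u x"
    by (rule weak_grad_AE_eq[OF assms(2) wg])
  have "weak_solution \<Omega> F H u"
    unfolding weak_solution_def Let_def
  proof (intro conjI allI impI assms(6,12) wd)
    fix \<phi> :: "real ^ 'm \<Rightarrow> real" assume \<phi>: "test_function \<Omega> \<phi>"
    \<comment> \<open>The definition uses the singular set of the chosen weak gradient. It agrees
      with the pointwise set \<open>S\<close> up to a null set, so it is null as well.\<close>
    let ?S = "singular_set \<Omega> F ?w"
    have 1: "(LINT x:?S|lebesgue. norm (grad \<phi> x)) = 0"
      unfolding set_lebesgue_integral_def
    proof (rule integral_eq_zero_AE)
      show "AE x in lebesgue. indicator ?S x *\<^sub>R norm (grad \<phi> x) = 0"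
        using nS wae by eventually_elim (auto simp: S_def singular_set_def indicator_def)
    qed
    have "AE x in lebesgue. indicator \<Omega> x *\<^sub>R (?N x \<bullet> grad \<phi> x) =
        indicator (\<Omega> - ?S) x *\<^sub>R (direction F ?w x \<bullet> grad \<phi> x)"
      using nS wae by eventually_elim (auto simp: S_def singular_set_def indicator_def direction_def)
    from integrable_lebesgue_AE_cong(2)[OF main(1)[OF \<phi>, unfolded set_integrable_def] this]
    have "(LINT x:\<Omega> - ?S|lebesgue. direction F ?w x \<bullet> grad \<phi> x) = (LINT x:\<Omega>|lebesgue. ?N x \<bullet> grad \<phi> x)"
      by (simp only: set_lebesgue_integral_def)
    with 1 main(2)[OF \<phi>]
    show "(LINT x:?S|lebesgue. norm (grad \<phi> x)) + (LINT x:\<Omega> - ?S|lebesgue. direction F ?w x \<bullet> grad \<phi> x)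
        + (LINT x:\<Omega>|lebesgue. H x * \<phi> x) \<ge> 0" by simp
  qed
  moreover have "is_minimizer \<Omega> F H u"
    if W: "W11 \<Omega> u" and Hb: "L_infinity \<Omega> H" and Fi: "F absolutely_integrable_on \<Omega>"
    unfolding is_minimizer_def
  proof (intro conjI allI impI W Hb Fi)
    fix \<phi> assume "W11_0 \<Omega> \<phi>"
    then obtain \<psi> where \<phi>: "W11 \<Omega> \<phi>" and \<psi>: "\<And>n::nat. test_function \<Omega> (\<psi> n)"
      and lim: "(\<lambda>n. W11_norm \<Omega> (\<lambda>x. \<psi> n x - \<phi> x)) \<longlonglongrightarrow> 0"
      by (auto simp: W11_0_def)
    let ?g = "weak_grad \<Omega> \<phi>"
    have i\<phi>: "set_integrable lebesgue \<Omega> \<phi>" "set_integrable lebesgue \<Omega> ?g" "has_weak_grad \<Omega> \<phi> ?g"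
      using \<phi> by (auto simp: W11_def intro: has_weak_grad_weak_grad)
    have iu: "set_integrable lebesgue \<Omega> u" "set_integrable lebesgue \<Omega> ?w"
      using W by (auto simp: W11_def)
    obtain M where M: "M \<ge> 0"
      "\<And>w. set_integrable lebesgue \<Omega> w \<Longrightarrow> set_integrable lebesgue \<Omega> (\<lambda>x. H x * w x)"
      "\<And>w. set_integrable lebesgue \<Omega> w \<Longrightarrow>
        \<bar>LINT x:\<Omega>|lebesgue. H x * w x\<bar> \<le> M * (LINT x:\<Omega>|lebesgue. \<bar>w x\<bar>)"
      using L_infinity_mult[OF mem Hb] by blast
    have mN: "(\<lambda>x. indicator \<Omega> x *\<^sub>R ?N x) \<in> borel_measurable lebesgue"
    proof (rule borel_measurable_AE)
      have "(\<lambda>x. indicator (\<Omega> - S) x *\<^sub>R ?N x) \<in> borel_measurable borel"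
        using N(1) oU by (intro borel_measurable_continuous_on_indicator)
          (auto intro!: continuous_at_imp_continuous_on differentiable_imp_continuous_within)
      then show "(\<lambda>x. indicator (\<Omega> - S) x *\<^sub>R ?N x) \<in> borel_measurable lebesgue"
        by (intro measurable_completion) simp
      show "AE x in lebesgue. indicator (\<Omega> - S) x *\<^sub>R ?N x = indicator \<Omega> x *\<^sub>R ?N x"
        using nS by eventually_elim (auto simp: indicator_def)
    qed
    have N1': "AE x in lebesgue. x \<in> \<Omega> \<longrightarrow> norm (?N x) \<le> 1"
      using N1 by simp
    note Nin = set_integrable_bounded_inner[OF mN N1']
    let ?I = "(LINT x:\<Omega>|lebesgue. ?N x \<bullet> ?g x) + (LINT x:\<Omega>|lebesgue. H x * \<phi> x)"
    \<comment> \<open>The left side of the identity is linear and vanishes for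
      \<open>\<psi> n\<close>. Thus \<open>?I\<close> is, up to sign, its value at the difference
      \<open>\<psi> n - \<phi>\<close>, which is at most a multiple of the W^{1,1} norm tending to
      0.\<close>
    have est: "\<bar>?I\<bar> \<le> (1 + M) * W11_norm \<Omega> (\<lambda>x. \<psi> n x - \<phi> x)" for n
    proof -
      note d = W11_test_function_diff[OF assms(2) \<phi> \<psi>[of n]]
      have d1: "set_integrable lebesgue \<Omega> (\<lambda>x. grad (\<psi> n) x - ?g x)" "set_integrable lebesgue \<Omega> (\<lambda>x. \<psi> n x - \<phi> x)"
        by (intro set_integral_diff d i\<phi>)+
      have e1: "(LINT x:\<Omega>|lebesgue. ?N x \<bullet> (grad (\<psi> n) x - ?g x)) =
          (LINT x:\<Omega>|lebesgue. ?N x \<bullet> grad (\<psi> n) x) - (LINT x:\<Omega>|lebesgue. ?N x \<bullet> ?g x)"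
        unfolding inner_diff_right by (intro set_integral_diff(2) Nin(1) d i\<phi>)
      have e2: "(LINT x:\<Omega>|lebesgue. H x * (\<psi> n x - \<phi> x)) =
          (LINT x:\<Omega>|lebesgue. H x * \<psi> n x) - (LINT x:\<Omega>|lebesgue. H x * \<phi> x)"
        unfolding right_diff_distrib by (intro set_integral_diff(2) M(2) d i\<phi>)
      have b: "0 \<le> (LINT x:\<Omega>|lebesgue. \<bar>\<psi> n x - \<phi> x\<bar>)" "0 \<le> (LINT x:\<Omega>|lebesgue. norm (grad (\<psi> n) x - ?g x))"
        unfolding set_lebesgue_integral_def by (intro Bochner_Integration.integral_nonneg; simp)+
      have "\<bar>?I\<bar> = \<bar>(LINT x:\<Omega>|lebesgue. ?N x \<bullet> (grad (\<psi> n) x - ?g x)) + (LINT x:\<Omega>|lebesgue. H x * (\<psi> n x - \<phi> x))\<bar>"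
        unfolding e1 e2 using main(2)[OF \<psi>[of n]] by linarith
      also have "\<dots> \<le> 1 * (LINT x:\<Omega>|lebesgue. norm (grad (\<psi> n) x - ?g x)) + M * (LINT x:\<Omega>|lebesgue. \<bar>\<psi> n x - \<phi> x\<bar>)"
        by (rule order_trans[OF abs_triangle_ineq add_mono[OF Nin(2)[OF d1(1)] M(3)[OF d1(2)]]])
      also have "\<dots> \<le> (1 + M) * W11_norm \<Omega> (\<lambda>x. \<psi> n x - \<phi> x)"
        unfolding d(3) using b M(1) mult_nonneg_nonneg[OF M(1) b(2)] by (simp add: algebra_simps)
      finally show ?thesis .
    qed
    have "(\<lambda>n. (1 + M) * W11_norm \<Omega> (\<lambda>x. \<psi> n x - \<phi> x)) \<longlonglongrightarrow> (1 + M) * 0"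
      by (intro tendsto_mult tendsto_const lim)
    then have "\<bar>?I\<bar> \<le> (1 + M) * 0"
      by (rule LIMSEQ_le_const) (use est in blast)
    then have I0: "?I = 0" by simp
    have "has_weak_grad \<Omega> (\<lambda>x. u x + \<phi> x) (\<lambda>x. grad u x + ?g x)"
      by (rule has_weak_grad_add[OF wg i\<phi>(3)])
    note wae' = weak_grad_AE_eq[OF assms(2) this]
    have igu: "set_integrable lebesgue \<Omega> (grad u)"
      by (rule set_integral_AE_cong(1)[OF iu(2) wae])
    have a1: "set_integrable lebesgue \<Omega> (\<lambda>x. norm (grad u x + F x) + H x * u x)"
      by (intro set_integral_add set_integrable_norm igu Fi M(2) iu)
    have a2: "set_integrable lebesgue \<Omega> (\<lambda>x. norm (grad u x + ?g x + F x) + H x * (u x + \<phi> x))"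
      by (intro set_integral_add set_integrable_norm igu Fi M(2) iu i\<phi>)
    have a3: "set_integrable lebesgue \<Omega> (\<lambda>x. ?N x \<bullet> ?g x + H x * \<phi> x)"
      by (intro set_integral_add Nin(1) M(2) i\<phi>)
    have "AE x in lebesgue. x \<in> \<Omega> \<longrightarrow>
        norm (grad u x + F x) + H x * u x = norm (?w x + F x) + H x * u x"
      using wae by eventually_elim auto
    from set_integral_AE_cong(2)[OF a1 this]
    have A1: "area_functional \<Omega> F H u = (LINT x:\<Omega>|lebesgue. norm (grad u x + F x) + H x * u x)"
      by (simp only: area_functional_def)
    have "AE x in lebesgue. x \<in> \<Omega> \<longrightarrow> norm (grad u x + ?g x + F x) + H x * (u x + \<phi> x) =
        norm (weak_grad \<Omega> (\<lambda>x. u x + \<phi> x) x + F x) + H x * (u x + \<phi> x)"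
      using wae' by eventually_elim auto
    from set_integral_AE_cong(2)[OF a2 this]
    have A2: "area_functional \<Omega> F H (\<lambda>x. u x + \<phi> x) =
        (LINT x:\<Omega>|lebesgue. norm (grad u x + ?g x + F x) + H x * (u x + \<phi> x))"
      by (simp only: area_functional_def)
    \<comment> \<open>Adding the vanishing term \<open>?I\<close> reduces minimality to an
      inequality between integrands, valid off the null set \<open>S\<close>.\<close>
    have "area_functional \<Omega> F H u = area_functional \<Omega> F H u + ?I"
      using I0 by simp
    also have "\<dots> = (LINT x:\<Omega>|lebesgue. (norm (grad u x + F x) + H x * u x) + (?N x \<bullet> ?g x + H x * \<phi> x))"
      unfolding A1 using set_integral_add(2)[OF a1 a3] set_integral_add(2)[OF Nin(1)[OF i\<phi>(2)] M(2)[OF i\<phi>(1)]]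
      by simp
    also have "\<dots> \<le> area_functional \<Omega> F H (\<lambda>x. u x + \<phi> x)"
      unfolding A2
    proof (rule set_integral_mono_AE[OF set_integral_add(1)[OF a1 a3] a2])
      show "AE x\<in>\<Omega> in lebesgue. (norm (grad u x + F x) + H x * u x) + (?N x \<bullet> ?g x + H x * \<phi> x)
          \<le> norm (grad u x + ?g x + F x) + H x * (u x + \<phi> x)"
        using nS
      proof eventually_elim
        case (elim x)
        show ?case
        proof
          assume "x \<in> \<Omega>"
          let ?p = "grad u x + F x"
          have p: "?p \<noteq> 0" using nz[of x] \<open>x \<in> \<Omega>\<close> elim by blast
          \<comment> \<open>Since \<open>?N x \<bullet> ?p\<close> is the norm of \<open>?p\<close>,
            the left side is \<open>?N x \<bullet> (?p + ?g x)\<close>, and Cauchy-Schwarz with the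
            bound 1 on the norm of \<open>?N x\<close> finishes.\<close>
          have "?N x \<bullet> ?p = inverse (norm ?p) * (norm ?p)\<^sup>2"
            unfolding direction_def inner_scaleR_left power2_norm_eq_inner by (rule refl)
          also have "\<dots> = norm ?p" using p by (simp add: power2_eq_square)
          finally have "norm ?p + ?N x \<bullet> ?g x = ?N x \<bullet> (?p + ?g x)"
            by (simp only: inner_add_right[of "?N x" ?p])
          also have "\<dots> \<le> norm (?N x) * norm (?p + ?g x)" by (rule norm_cauchy_schwarz)
          also have "\<dots> \<le> 1 * norm (?p + ?g x)" by (intro mult_right_mono N1) simp
          finally show "(norm ?p + H x * u x) + (?N x \<bullet> ?g x + H x * \<phi> x)
              \<le> norm (grad u x + ?g x + F x) + H x * (u x + \<phi> x)"
            by (simp add: algebra_simps)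
        qed
      qed
    qed
    finally show "area_functional \<Omega> F H u \<le> area_functional \<Omega> F H (\<lambda>x. u x + \<phi> x)" .
  qed
  ultimately show ?thesis by blast
qed

end
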